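(* Let $\rho\in(0,1)$. For every $\alpha_0>0$ there exists a constant $\kappa>0$, depending only on $\rho$ (and on $\alpha_0$), and not on $\alpha$, such that the following holds for every $\alpha\in[\alpha_0,2]$ for which $\rho$ is an admissible positivity parameter. Let $Z$ be a Lévy $\alpha$-stable process with scaling parameter $1$ and positivity parameter $\mathbb{P}[Z_1>0]=\rho$, and suppose that $Z$ has negative jumps and is not the negative of a subordinator. Let $$A_t=\int_0^t Z_s\,ds,\quad t\ge 0,\qquad T=\inf\{t>0:\ A_t=1\}.$$ Then $$\liminf_{t\to\infty}\ t^{\kappa}\,\mathbb{P}[T>t]\;=\;0.$$
   Context: For $\alpha\in(0,2]$, a Lévy $\alpha$-stable process $Z=\{Z_x,\ x\ge0\}$ is a real càdlàg process with $Z_0=0$, with stationary and independent increments, which is $(1/\alpha)$-self-similar: $\{Z_{kx},\,x\ge0\}$ has the same law as $\{k^{1/\alpha}Z_x,\,x\ge 0\}$ for all $k>0$. Its exponent $\Psi(\lambda)=-\log\mathbb{E}[e^{i\lambda Z_1}]$, normalized to have scaling parameter $1$, is $$\Psi(\lambda)=|\lambda|^\alpha\bigl(1-i\beta\,\mathrm{sgn}(\lambda)\tan(\pi\alpha/2)\bigr),\quad\lambda\in\mathbb{R},$$ with skewness parameter $\beta\in[-1,1]$ for $\alpha\ne1$; for $\alpha=1$ (strictly stable case) it is $\Psi(\lambda)=|\lambda|-id\lambda$ with $d\in\mathbb{R}$. The positivity parameter is $\rho=\mathbb{P}[Z_1>0]$. Its admissible values are $[1-1/\alpha,1/\alpha]$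 when $\alpha>1$, $(0,1)$ when $\alpha=1$, and $[0,1]$ when $\alpha<1$. When $\alpha>1$, the value $\rho=1-1/\alpha$ corresponds to $Z$ having no negative jumps and $\rho=1/\alpha$ to $Z$ having no positive jumps. When $\alpha<1$, $\rho=0$ means that $Z$ is the negative of a subordinator and $\rho=1$ means that $Z$ is a subordinator. When $\alpha=1$, $Z$ has jumps in both directions. When $\alpha=2$, $Z$ is a multiple of Brownian motion. *)

theory Defs
  imports "HOL-Probability.Probability"
begin

definition cadlag :: "(real \<Rightarrow> real) \<Rightarrow> bool" where
  "cadlag f \<longleftrightarrow>
     (\<forall>t\<ge>0. (f \<longlongrightarrow> f t) (at_right t)) \<and>
     (\<forall>t>0. \<exists>l. (f \<longlongrightarrow> l) (at_left t))"

definition jump :: "(real \<Rightarrow> real) \<Rightarrow> real \<Rightarrow> real" where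
  "jump f t = f t - Lim (at_left t) f"

text \<open>The time index is real, but only the values at nonnegative times are constrained or used.\<close>

locale levy_process = prob_space M
  for M :: "'a measure" +
  fixes Z :: "real \<Rightarrow> 'a \<Rightarrow> real"
  assumes measurable_Z: "\<And>t. 0 \<le> t \<Longrightarrow> Z t \<in> borel_measurable M"
    and start_zero: "AE \<omega> in M. Z 0 \<omega> = 0"
    and cadlag_paths: "\<And>\<omega>. \<omega> \<in> space M \<Longrightarrow> cadlag (\<lambda>t. Z t \<omega>)"
    and stationary_increments: "\<And>s h. 0 \<le> s \<Longrightarrow> 0 \<le> h \<Longrightarrow>
      distr M borel (\<lambda>\<omega>. Z (s + h) \<omega> - Z s \<omega>) = distr M borel (\<lambda>\<omega>. Z h \<omega> - Z 0 \<omega>)"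
    and independent_increments: "\<And>(n::nat) t. 0 \<le> t 0 \<Longrightarrow> (\<And>i. i < n \<Longrightarrow> t i \<le> t (Suc i)) \<Longrightarrow>
      indep_vars (\<lambda>_. borel) (\<lambda>i \<omega>. Z (t (Suc i)) \<omega> - Z (t i) \<omega>) {..<n}"

text \<open>Equality in law of the two processes, as measures on the product space over
  the nonnegative times.\<close>

definition self_similar :: "'a measure \<Rightarrow> real \<Rightarrow> (real \<Rightarrow> 'a \<Rightarrow> real) \<Rightarrow> bool" where
  "self_similar M H Z \<longleftrightarrow> (\<forall>k>0.
     distr M (Pi\<^sub>M {0..} (\<lambda>_. borel)) (\<lambda>\<omega>. \<lambda>x\<in>{0..}. Z (k * x) \<omega>) =
     distr M (Pi\<^sub>M {0..} (\<lambda>_. borel)) (\<lambda>\<omega>. \<lambda>x\<in>{0..}. k powr H * Z x \<omega>))"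

definition stable_process :: "'a measure \<Rightarrow> real \<Rightarrow> (real \<Rightarrow> 'a \<Rightarrow> real) \<Rightarrow> bool" where
  "stable_process M \<alpha> Z \<longleftrightarrow>
     \<alpha> \<in> {0<..2} \<and> levy_process M Z \<and> self_similar M (1 / \<alpha>) Z"

definition stable_exponent :: "real \<Rightarrow> real \<Rightarrow> real \<Rightarrow> complex" where
  "stable_exponent \<alpha> \<beta> \<theta> =
     of_real (\<bar>\<theta>\<bar> powr \<alpha>) * (1 - \<i> * of_real (\<beta> * sgn \<theta> * tan (pi * \<alpha> / 2)))"

definition stable_exponent_one :: "real \<Rightarrow> real \<Rightarrow> complex" where
  "stable_exponent_one d \<theta> = of_real \<bar>\<theta>\<bar> - \<i> * of_real (d * \<theta>)"

text \<open>The relation between the exponent and the characteristic function is written as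
  \<open>E[exp (i \<theta> Z\<^sub>1)] = exp (- \<Psi> \<theta>)\<close>, which fixes the branch of the logarithm.\<close>

definition unit_scale :: "'a measure \<Rightarrow> real \<Rightarrow> (real \<Rightarrow> 'a \<Rightarrow> real) \<Rightarrow> bool" where
  "unit_scale M \<alpha> Z \<longleftrightarrow>
     (if \<alpha> = 1
      then \<exists>d. \<forall>\<theta>. char (distr M borel (Z 1)) \<theta> = exp (- stable_exponent_one d \<theta>)
      else \<exists>\<beta>\<in>{-1..1}. \<forall>\<theta>. char (distr M borel (Z 1)) \<theta> = exp (- stable_exponent \<alpha> \<beta> \<theta>))"

definition positivity_parameter :: "'a measure \<Rightarrow> (real \<Rightarrow> 'a \<Rightarrow> real) \<Rightarrow> real" where
  "positivity_parameter M Z = measure M {\<omega> \<in> space M. Z 1 \<omega> > 0}"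

definition admissible_positivity :: "real \<Rightarrow> real set" where
  "admissible_positivity \<alpha> =
     (if \<alpha> > 1 then {1 - 1 / \<alpha> .. 1 / \<alpha>} else if \<alpha> = 1 then {0<..<1} else {0..1})"

definition has_negative_jumps :: "'a measure \<Rightarrow> (real \<Rightarrow> 'a \<Rightarrow> real) \<Rightarrow> bool" where
  "has_negative_jumps M Z \<longleftrightarrow> \<not> (AE \<omega> in M. \<forall>t>0. \<not> jump (\<lambda>s. Z s \<omega>) t < 0)"

definition subordinator :: "'a measure \<Rightarrow> (real \<Rightarrow> 'a \<Rightarrow> real) \<Rightarrow> bool" where
  "subordinator M Z \<longleftrightarrow> levy_process M Z \<and> (AE \<omega> in M. mono_on {0..} (\<lambda>t. Z t \<omega>))"

definition integrated :: "(real \<Rightarrow> 'a \<Rightarrow> real) \<Rightarrow> real \<Rightarrow> 'a \<Rightarrow> real" where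
  "integrated Z t \<omega> = (LINT s:{0..t}|lborel. Z s \<omega>)"

text \<open>The infimum is taken in \<open>ereal\<close>, so it is \<open>\<infinity>\<close> on paths that never reach the level.\<close>

definition hitting_time_one :: "(real \<Rightarrow> 'a \<Rightarrow> real) \<Rightarrow> 'a \<Rightarrow> ereal" where
  "hitting_time_one A \<omega> = Inf (ereal ` {t. t > 0 \<and> A t \<omega> = 1})"

text \<open>\<open>decay_exponent TYPE('a) \<rho> \<alpha>\<^sub>0 \<kappa>\<close> is the assertion about a given \<open>\<kappa>\<close>, for all processes on
  all probability spaces over the type \<open>'a\<close>. A formula of HOL cannot quantify over types, so the
  type of sample points is made a parameter in order to be able to say that one and the same
  \<open>\<kappa>\<close> serves all of them. The type \<open>real \<Rightarrow> real\<close> contains the paths and so carries the law of every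
  process.\<close>

definition decay_exponent :: "'a itself \<Rightarrow> real \<Rightarrow> real \<Rightarrow> real \<Rightarrow> bool" where
  "decay_exponent (_ :: 'a itself) \<rho> \<alpha>\<^sub>0 \<kappa> \<longleftrightarrow>
     (\<forall>\<alpha>\<in>{\<alpha>\<^sub>0..2}. \<rho> \<in> admissible_positivity \<alpha> \<longrightarrow>
       (\<forall>(M :: 'a measure) Z.
          stable_process M \<alpha> Z \<and> unit_scale M \<alpha> Z \<and> positivity_parameter M Z = \<rho> \<and>
          has_negative_jumps M Z \<and> \<not> subordinator M (\<lambda>t \<omega>. - Z t \<omega>) \<longrightarrow>
          Liminf at_top (\<lambda>t. ereal (t powr \<kappa> *
            measure M {\<omega> \<in> space M. hitting_time_one (integrated Z) \<omega> > ereal t})) = 0))"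

end

theory Submission
  imports Defs
begin

text \<open>
  Since \<open>A\<close> is continuous with \<open>A\<^sub>0 = 0\<close>, the event \<open>T > R\<^sup>n\<close> forces \<open>A < 1\<close> at the times
  \<open>1, R, \<dots>, R\<^sup>n\<close>. Over a block \<open>[R\<^sup>n, R\<^sup>n\<^sup>+\<^sup>1]\<close> the increments of \<open>Z\<close> and \<open>A\<close> are, up to the
  contribution of the current state, independent of the past and distributed like the stable law
  itself up to scaling. Let \<open>V\<^sub>n\<close> be the size of the state \<open>(Z, A)\<close> at time \<open>R\<^sup>n\<close>, rescaled by
  self-similarity. If \<open>V\<^sub>n\<close> is moderate, then with probability bounded below the block pushes \<open>A\<close>
  above \<open>1\<close>; if \<open>V\<^sub>n\<close> is large, the rescaling makes it contract. Hence
  \<open>E[(1 + \<eta> V\<^sub>n\<^sup>\<gamma>); A < 1 up to R\<^sup>n]\<close> decays geometrically in \<open>n\<close>, which is a power of time.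

  All constants depend only on \<open>\<rho>\<close> and \<open>\<alpha>\<^sub>0\<close>. The point that needs care is \<open>\<alpha>\<close> near \<open>1\<close>, where the
  coefficient \<open>b = \<beta> tan (\<pi>\<alpha>/2)\<close> may be large; but then \<open>Z\<^sub>1\<close> is close to a large constant of the sign
  of \<open>b\<close>, which is incompatible with \<open>P[Z\<^sub>1 > 0] = \<rho>\<close>.

  The estimates are carried out for Riemann sums of \<open>A\<close> with mesh \<open>1/m\<close>, uniformly in \<open>m\<close>, so that only
  finitely many independent increments are involved before the final limit \<open>m \<rightarrow> \<infinity>\<close>.
\<close>

section \<open>Gaussian smoothing of characteristic functions\<close>

abbreviation "gauss \<equiv> std_normal_distribution"

interpretation gauss: real_distribution gauss
  by (rule real_dist_normal_dist)

lemma (in real_distribution) gauss_integral_char: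
  "(CLINT g|gauss. char M g) = of_real (LINT x|M. exp (- x\<^sup>2 / 2))"
proof -
  interpret pair_prob_space gauss M ..
  have "integrable (gauss \<Otimes>\<^sub>M M) (\<lambda>(g, x). iexp (g * x))"
    by (rule integrable_const_bound[where B = 1]) (auto simp: split_beta)
  then have "(CLINT x|M. CLINT g|gauss. iexp (g * x)) = (CLINT g|gauss. CLINT x|M. iexp (g * x))"
    by (rule Fubini_integral)
  moreover have "(CLINT g|gauss. iexp (g * x)) = of_real (exp (- x\<^sup>2 / 2))" for x
    using fun_cong[OF char_std_normal_distribution, of x] by (simp add: char_def mult.commute)
  ultimately show ?thesis
    by (simp add: char_def)
qed

lemma (in real_distribution) integrable_char_gauss: "integrable gauss (char M)"
  by (rule gauss.integrable_const_bound[where B = 1]) (auto simp: cmod_char_le_1)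

lemma (in real_distribution) integrable_exp_square: "integrable M (\<lambda>x. exp (- x\<^sup>2 / 2))"
  by (rule integrable_const_bound[where B = 1]) auto

lemma (in real_distribution) concentration_le:
  "measure M {-1..1} \<le> exp (1/2) * (LINT g|gauss. cmod (char M g))"
proof -
  have "measure M {-1..1} = (LINT x|M. indicator {-1..1} x)"
    by simp
  also have "\<dots> \<le> (LINT x|M. exp (1/2) * exp (- x\<^sup>2 / 2))"
  proof (intro integral_mono)
    show "indicator {-1..1} x \<le> exp (1/2) * exp (- x\<^sup>2 / 2)" for x :: real
    proof (cases "x \<in> {-1..1}")
      case True
      then have "x\<^sup>2 \<le> 1" by (simp add: abs_square_le_1 abs_le_iff)
      then show ?thesis by (simp add: exp_add[symmetric] indicator_def)
    qed simp
    show "integrable M (\<lambda>x. exp (1/2) * exp (- x\<^sup>2 / 2))"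
      by (intro integrable_mult_right integrable_exp_square)
  qed (auto intro!: integrable_real_indicator simp: emeasure_eq_measure)
  also have "\<dots> = exp (1/2) * cmod (CLINT g|gauss. char M g)"
    by (simp add: gauss_integral_char)
  also have "\<dots> \<le> exp (1/2) * (LINT g|gauss. cmod (char M g))"
    by (intro mult_left_mono integral_norm_bound) auto
  finally show ?thesis .
qed

lemma (in real_distribution) tail_le:
  "measure M {x. 1 \<le> \<bar>x\<bar>} \<le> 3 * (LINT g|gauss. cmod (1 - char M g))"
proof -
  have e: "exp (-1/2::real) \<le> 2/3"
  proof -
    have "1 + 1/2 \<le> exp (1/2::real)" by (rule exp_ge_add_one_self)
    then have "inverse (exp (1/2::real)) \<le> inverse (3/2)" by (intro le_imp_inverse_le) auto
    then show ?thesis by (simp add: exp_minus)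
  qed
  have "measure M {x. 1 \<le> \<bar>x\<bar>} = (LINT x|M. indicator {x. 1 \<le> \<bar>x\<bar>} x)"
    by simp
  also have "\<dots> \<le> (LINT x|M. 3 * (1 - exp (- x\<^sup>2 / 2)))"
  proof (intro integral_mono)
    show "indicator {x. 1 \<le> \<bar>x\<bar>} x \<le> 3 * (1 - exp (- x\<^sup>2 / 2))" for x :: real
    proof (cases "1 \<le> \<bar>x\<bar>")
      case True
      then have "1 \<le> x\<^sup>2" using abs_le_square_iff[of 1 x] by simp
      then have "exp (- x\<^sup>2 / 2) \<le> exp (-1/2)" by simp
      with e have "1 \<le> 3 * (1 - exp (- x\<^sup>2 / 2))" by argo
      with True show ?thesis by (simp add: indicator_def)
    qed simp
    show "integrable M (\<lambda>x. 3 * (1 - exp (- x\<^sup>2 / 2)))"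
      by (intro integrable_mult_right Bochner_Integration.integrable_diff integrable_exp_square) simp
  qed (auto intro!: integrable_real_indicator simp: emeasure_eq_measure)
  also have "\<dots> = 3 * (1 - (LINT x|M. exp (- x\<^sup>2 / 2)))"
    using integrable_exp_square prob_space by simp
  also have "\<dots> \<le> 3 * cmod (1 - (CLINT g|gauss. char M g))"
    using norm_ge_zero abs_Re_le_cmod[of "1 - (CLINT g|gauss. char M g)"]
    by (simp add: gauss_integral_char)
  also have "1 - (CLINT g|gauss. char M g) = (CLINT g|gauss. 1 - char M g)"
    using integrable_char_gauss gauss.prob_space by simp
  also have "3 * cmod \<dots> \<le> 3 * (LINT g|gauss. cmod (1 - char M g))"
    by (intro mult_left_mono integral_norm_bound) auto
  finally show ?thesis .
qed

lemma (in real_distribution) char_distr_affine: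
  "char (distr M borel (\<lambda>x. c * x + d)) \<theta> = iexp (\<theta> * d) * char M (c * \<theta>)"
  by (simp add: char_def integral_distr exp_add[symmetric] algebra_simps
    flip: integral_mult_right_zero)

section \<open>Strictly stable laws\<close>

text \<open>Covers both normalizations of the exponent: \<open>b = d\<close> for \<open>\<alpha> = 1\<close> and \<open>b = \<beta> tan (\<pi>\<alpha>/2)\<close> otherwise.\<close>

definition strict_exponent :: "real \<Rightarrow> real \<Rightarrow> real \<Rightarrow> complex" where
  "strict_exponent \<alpha> b \<theta> = of_real (\<bar>\<theta>\<bar> powr \<alpha>) * (1 - \<i> * of_real (b * sgn \<theta>))"

lemma strict_exponent_scale:
  "0 \<le> c \<Longrightarrow> strict_exponent \<alpha> b (c * \<theta>) = of_real (c powr \<alpha>) * strict_exponent \<alpha> b \<theta>"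
  by (cases "c = 0") (simp_all add: strict_exponent_def abs_mult powr_mult sgn_mult)

lemma Re_strict_exponent [simp]: "Re (strict_exponent \<alpha> b \<theta>) = \<bar>\<theta>\<bar> powr \<alpha>"
  by (simp add: strict_exponent_def)

lemma Im_strict_exponent [simp]: "Im (strict_exponent \<alpha> b \<theta>) = - b * sgn \<theta> * \<bar>\<theta>\<bar> powr \<alpha>"
  by (simp add: strict_exponent_def)

lemma norm_one_minus_exp_le:
  assumes "0 \<le> Re z"
  shows "cmod (1 - exp (- z)) \<le> cmod z"
proof -
  have "cmod (exp (- 0) - exp (- z)) \<le> 1 * cmod (0 - z)"
  proof (rule field_differentiable_bound[where S = "{z. 0 \<le> Re z}"])
    show "convex {z. 0 \<le> Re z}"
      by (rule convex_halfspace_Re_ge)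
    show "((\<lambda>z. exp (- z)) has_field_derivative - exp (- u)) (at u within {z. 0 \<le> Re z})" for u
      by (auto intro!: derivative_eq_intros)
  qed (use assms in auto)
  then show ?thesis by simp
qed

lemma powr_le_one_plus_square:
  fixes x :: real
  assumes "0 \<le> x" "0 < a" "a \<le> 2"
  shows "x powr a \<le> 1 + x\<^sup>2"
proof (cases "x \<le> 1")
  case True
  then have "x powr a \<le> 1" using assms by (intro powr_le1) auto
  then show ?thesis by (simp add: add_increasing2)
next
  case False
  then have "x powr a \<le> x powr 2" using assms by (intro powr_mono) auto
  with False show ?thesis by simp
qed

lemma abs_powr_minus_self_le:
  fixes x :: real
  assumes "0 \<le> x" "\<bar>a - 1\<bar> \<le> 1/2"
  shows "\<bar>x powr a - x\<bar> \<le> \<bar>a - 1\<bar> * (2 + x ^ 4)"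
proof (cases "x = 0")
  case False
  with assms have x: "0 < x" by simp
  have bound: "norm (ln x * x powr u) \<le> 2 + x ^ 4" if "u \<in> {1/2..3/2}" for u
  proof (cases "x \<le> 1")
    case True
    have "ln (1 / sqrt x) \<le> 1 / sqrt x - 1" using x by (intro ln_le_minus_one) auto
    then have "- ln x \<le> 2 * (1 / sqrt x - 1)" using x by (simp add: ln_div ln_sqrt)
    then have "- ln x * sqrt x \<le> 2 * (1 / sqrt x - 1) * sqrt x"
      using x by (intro mult_right_mono) auto
    also have "\<dots> \<le> 2" using x by (simp add: field_simps)
    finally have "- ln x * sqrt x \<le> 2" .
    moreover have "x powr u \<le> sqrt x"
      using that True x powr_mono'[of "1/2" u x] by (simp add: powr_half_sqrt)
    then have "- ln x * x powr u \<le> - ln x * sqrt x"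
      using True x by (intro mult_left_mono) auto
    ultimately have "- ln x * x powr u \<le> 2" by linarith
    moreover have "norm (ln x * x powr u) = - ln x * x powr u"
      using True x by (simp add: abs_mult)
    ultimately show ?thesis by (simp add: add_increasing2)
  next
    case False
    have "ln x * x powr u \<le> x powr 1 * x powr (3/2)"
      using False that x ln_le_minus_one[of x] by (intro mult_mono powr_mono) auto
    also have "\<dots> \<le> x powr 4"
      using False x by (simp only: powr_add[symmetric]) (intro powr_mono, auto)
    also have "\<dots> = x ^ 4" using x by simp
    finally show ?thesis using False x by (simp add: abs_mult)
  qed
  have "norm (x powr a - x powr 1) \<le> (2 + x ^ 4) * norm (a - 1)"
  proof (rule field_differentiable_bound[where S = "{1/2..3/2}"])
    show "((\<lambda>u. x powr u) has_field_derivative (ln x * x powr u)) (at u within {1/2..3/2})" for u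
      using x by (auto intro!: derivative_eq_intros simp: powr_def)
    show "a \<in> {1/2..3/2}" using assms(2) by (simp add: abs_le_iff) argo
  qed (use bound in auto)
  then show ?thesis using x by (simp add: mult.commute)
qed auto

locale strictly_stable_law = real_distribution Q for Q +
  fixes \<alpha> b :: real
  assumes index: "0 < \<alpha>" "\<alpha> \<le> 2"
    \<comment> \<open>a consequence of \<open>|b| \<le> |tan (\<pi>\<alpha>/2)|\<close>, valid for \<open>\<alpha> = 1\<close> as well\<close>
    and skewness: "\<bar>\<alpha> - 1\<bar> * \<bar>b\<bar> \<le> 1"
    and char_eq: "char Q \<theta> = exp (- strict_exponent \<alpha> b \<theta>)"
begin

lemma char_distr_scale:
  "0 \<le> c \<Longrightarrow> char (distr Q borel (\<lambda>x. c * x)) \<theta> = exp (- (of_real (c powr \<alpha>) * strict_exponent \<alpha> b \<theta>))"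
  using char_distr_affine[of c 0 \<theta>] by (simp add: char_eq strict_exponent_scale)

end

definition gauss_moment :: real where
  "gauss_moment = (LINT g|gauss. 3 + g\<^sup>2 + g ^ 4)"

lemma integrable_gauss_moment: "integrable gauss (\<lambda>g. 3 + g\<^sup>2 + g ^ 4)"
  by (intro Bochner_Integration.integrable_add integrable_std_normal_distribution_moment) simp

lemma gauss_moment_nonneg: "0 \<le> gauss_moment"
  unfolding gauss_moment_def by (intro integral_nonneg_AE) simp

lemma (in real_distribution) tail_le_gauss_moment:
  assumes "\<And>g. cmod (1 - char M g) \<le> c * (3 + g\<^sup>2 + g ^ 4)"
  shows "measure M {x. 1 \<le> \<bar>x\<bar>} \<le> 3 * (c * gauss_moment)"
proof -
  have "(LINT g|gauss. cmod (1 - char M g)) \<le> (LINT g|gauss. c * (3 + g\<^sup>2 + g ^ 4))"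
    using assms by (intro integral_mono integrable_mult_right integrable_gauss_moment
      integrable_norm Bochner_Integration.integrable_diff integrable_char_gauss) auto
  also have "\<dots> = c * gauss_moment"
    by (simp add: gauss_moment_def)
  finally show ?thesis using tail_le by linarith
qed

context strictly_stable_law
begin

text \<open>The law of \<open>Z / |b|\<^sup>1\<^sup>/\<^sup>\<alpha>\<close> concentrates at \<open>sgn b\<close> as \<open>|b| \<rightarrow> \<infinity>\<close>, because then \<open>\<alpha> \<rightarrow> 1\<close>.\<close>

lemma skewness_bound:
  "min (measure Q {0<..}) (1 - measure Q {0<..}) * \<bar>b\<bar> \<le> 2 + 3 * gauss_moment"
proof (cases "2 \<le> \<bar>b\<bar>")
  case True
  define c where "c = \<bar>b\<bar> powr (- 1 / \<alpha>)"
  have c: "0 < c" "c powr \<alpha> = 1 / \<bar>b\<bar>"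
    using True index unfolding c_def by (simp_all only: powr_powr) (auto simp: powr_minus_divide)
  define S where "S = distr Q borel (\<lambda>x. c * x + - sgn b)"
  interpret S: real_distribution S
    unfolding S_def by (rule real_distribution_distr) simp
  have small: "\<bar>\<alpha> - 1\<bar> \<le> 1 / \<bar>b\<bar>" "\<bar>\<alpha> - 1\<bar> \<le> 1/2"
  proof -
    show *: "\<bar>\<alpha> - 1\<bar> \<le> 1 / \<bar>b\<bar>" using skewness True by (auto simp: field_simps)
    have "1 / \<bar>b\<bar> \<le> 1/2" using True by (simp add: field_simps)
    with * show "\<bar>\<alpha> - 1\<bar> \<le> 1/2" by simp
  qed
  have "cmod (1 - char S g) \<le> 1 / \<bar>b\<bar> * (3 + g\<^sup>2 + g ^ 4)" for g
  proof -
    define z where "z = of_real (1 / \<bar>b\<bar>) * strict_exponent \<alpha> b g + \<i> * of_real (g * sgn b)"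
    have "char S g = exp (- z)"
      using c unfolding S_def char_distr_affine char_eq
      by (simp add: strict_exponent_scale exp_add[symmetric] z_def add.commute)
    moreover have Re: "Re z = \<bar>g\<bar> powr \<alpha> / \<bar>b\<bar>" by (simp add: z_def)
    ultimately have "cmod (1 - char S g) \<le> cmod z"
      by (simp add: norm_one_minus_exp_le)
    also have "\<dots> \<le> \<bar>Re z\<bar> + \<bar>Im z\<bar>" by (rule cmod_le)
    also have "Im z = - (sgn b * sgn g * (\<bar>g\<bar> powr \<alpha> - \<bar>g\<bar>))"
    proof -
      have "Im z = - (b / \<bar>b\<bar>) * (sgn g * \<bar>g\<bar> powr \<alpha>) + g * sgn b" by (simp add: z_def)
      also have "b / \<bar>b\<bar> = sgn b" by (simp add: real_sgn_eq)
      also have "g * sgn b = sgn b * (sgn g * \<bar>g\<bar>)" by (simp add: sgn_mult_abs)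
      finally show ?thesis by (simp add: algebra_simps)
    qed
    also have "\<bar>- (sgn b * sgn g * (\<bar>g\<bar> powr \<alpha> - \<bar>g\<bar>))\<bar> \<le> \<bar>\<bar>g\<bar> powr \<alpha> - \<bar>g\<bar>\<bar>"
      by (simp add: abs_mult sgn_if)
    also have "\<dots> \<le> \<bar>\<alpha> - 1\<bar> * (2 + g ^ 4)"
      using abs_powr_minus_self_le[of "\<bar>g\<bar>" \<alpha>] small by simp
    also have "\<dots> \<le> 1 / \<bar>b\<bar> * (2 + g ^ 4)"
      using small by (intro mult_right_mono) auto
    also have "\<bar>Re z\<bar> \<le> (1 + g\<^sup>2) / \<bar>b\<bar>"
      using powr_le_one_plus_square[of "\<bar>g\<bar>" \<alpha>] index unfolding Re
      by (simp add: divide_right_mono)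
    finally show ?thesis by (simp add: add_divide_distrib)
  qed
  then have "measure S {x. 1 \<le> \<bar>x\<bar>} \<le> 3 * (1 / \<bar>b\<bar> * gauss_moment)"
    by (rule S.tail_le_gauss_moment)
  moreover have "measure S {x. 1 \<le> \<bar>x\<bar>} = measure Q {x. 1 \<le> \<bar>c * x + - sgn b\<bar>}"
    unfolding S_def by (subst measure_distr) (auto simp: vimage_def)
  moreover have "min (measure Q {0<..}) (1 - measure Q {0<..}) \<le> measure Q {x. 1 \<le> \<bar>c * x + - sgn b\<bar>}"
  proof (cases "b < 0")
    case True
    have "measure Q {0<..} \<le> measure Q {x. 1 \<le> \<bar>c * x + - sgn b\<bar>}"
      using True c by (intro finite_measure_mono) auto
    then show ?thesis by simp
  next
    case False
    have "0 < b" using False \<open>2 \<le> \<bar>b\<bar>\<close> by auto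
    have "1 - measure Q {0<..} = measure Q {..0}"
      using prob_compl[of "{0<..}"] by (simp add: Compl_eq_Diff_UNIV[symmetric])
    also have "\<dots> \<le> measure Q {x. 1 \<le> \<bar>c * x + - sgn b\<bar>}"
    proof (intro finite_measure_mono subsetI)
      fix x :: real assume "x \<in> {..0}"
      then have "c * x \<le> 0" using c by (intro mult_nonneg_nonpos) auto
      then show "x \<in> {x. 1 \<le> \<bar>c * x + - sgn b\<bar>}" using \<open>0 < b\<close> by simp
    qed simp
    finally show ?thesis by simp
  qed
  ultimately have "min (measure Q {0<..}) (1 - measure Q {0<..}) \<le> 3 * (1 / \<bar>b\<bar> * gauss_moment)"
    by linarith
  then show ?thesis using True by (simp add: field_simps)
next
  case False
  have "min (measure Q {0<..}) (1 - measure Q {0<..}) * \<bar>b\<bar> \<le> 1 * \<bar>b\<bar>"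
    by (intro mult_right_mono) auto
  then show ?thesis using False gauss_moment_nonneg by linarith
qed

lemma tail_powr_le:
  assumes "0 < x"
  shows "measure Q {z. x \<le> \<bar>z\<bar>} \<le> 3 * ((1 + \<bar>b\<bar>) * gauss_moment) * x powr (- \<alpha>)"
proof -
  define S where "S = distr Q borel (\<lambda>z. 1 / x * z)"
  interpret S: real_distribution S
    unfolding S_def by (rule real_distribution_distr) simp
  have "cmod (1 - char S g) \<le> (1 + \<bar>b\<bar>) * x powr (- \<alpha>) * (3 + g\<^sup>2 + g ^ 4)" for g
  proof -
    have "cmod (1 - char S g) \<le> cmod (of_real ((1 / x) powr \<alpha>) * strict_exponent \<alpha> b g)"
      using assms unfolding S_def by (subst char_distr_scale) (simp, intro norm_one_minus_exp_le, simp)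
    also have "\<dots> = x powr (- \<alpha>) * cmod (strict_exponent \<alpha> b g)"
      using assms by (simp add: norm_mult norm_divide powr_divide powr_minus_divide)
    also have "cmod (strict_exponent \<alpha> b g) \<le> \<bar>g\<bar> powr \<alpha> * (1 + \<bar>b\<bar>)"
      using cmod_le[of "strict_exponent \<alpha> b g"]
      by (rule order_trans) (auto simp: abs_mult sgn_if algebra_simps)
    also have "\<dots> \<le> (1 + g\<^sup>2) * (1 + \<bar>b\<bar>)"
      using powr_le_one_plus_square[of "\<bar>g\<bar>" \<alpha>] index by (intro mult_right_mono) auto
    also have "\<dots> \<le> (3 + g\<^sup>2 + g ^ 4) * (1 + \<bar>b\<bar>)"
      by (intro mult_right_mono) auto
    finally have "cmod (1 - char S g) \<le> x powr (- \<alpha>) * ((3 + g\<^sup>2 + g ^ 4) * (1 + \<bar>b\<bar>))"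
      by (simp add: mult_left_mono)
    then show ?thesis by (simp only: ac_simps)
  qed
  then have "measure S {z. 1 \<le> \<bar>z\<bar>} \<le> 3 * ((1 + \<bar>b\<bar>) * x powr (- \<alpha>) * gauss_moment)"
    by (rule S.tail_le_gauss_moment)
  also have "\<dots> = 3 * ((1 + \<bar>b\<bar>) * gauss_moment) * x powr (- \<alpha>)"
    by (simp only: ac_simps)
  moreover have "measure S {z. 1 \<le> \<bar>z\<bar>} = measure Q {z. x \<le> \<bar>z\<bar>}"
    using assms unfolding S_def by (subst measure_distr) (auto simp: vimage_def field_simps)
  ultimately show ?thesis by simp
qed

end

lemma (in real_distribution) moment_le_of_tail:
  assumes tail: "\<And>x. 1 \<le> x \<Longrightarrow> measure M {z. x \<le> \<bar>z\<bar>} \<le> C * x powr (- a)"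
    and "0 < \<gamma>" "\<gamma> < a"
  shows "integrable M (\<lambda>z. \<bar>z\<bar> powr \<gamma>)"
    and "(LINT z|M. \<bar>z\<bar> powr \<gamma>) \<le> 1 + C * 2 powr \<gamma> / (1 - 2 powr (\<gamma> - a))"
proof -
  define D where "D = (\<lambda>n::nat. C * 2 powr \<gamma> * (2 powr (\<gamma> - a)) ^ n)"
  have C: "0 \<le> C" using order_trans[OF measure_nonneg tail[of 1]] by simp
  have "2 powr (\<gamma> - a) < 1" using \<open>\<gamma> < a\<close> by (simp add: powr_less_one)
  then have D: "D sums (C * 2 powr \<gamma> * (1 / (1 - 2 powr (\<gamma> - a))))"
    unfolding D_def by (intro sums_mult geometric_sums) auto
  have "0 \<le> D n" for n using C by (simp add: D_def)
  have le_suminf: "f n \<le> (\<Sum>n. f n)" for f :: "nat \<Rightarrow> ennreal" and n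
    using sum_le_suminf[of f "{n}"] by simp
  have pointwise: "ennreal (\<bar>z\<bar> powr \<gamma>) \<le>
      1 + (\<Sum>n. ennreal (2 powr ((n + 1) * \<gamma>)) * indicator {z. 2 ^ n \<le> \<bar>z\<bar>} z)" for z
  proof (cases "1 \<le> \<bar>z\<bar>")
    case True
    define n where "n = nat \<lfloor>log 2 \<bar>z\<bar>\<rfloor>"
    have "0 \<le> log 2 \<bar>z\<bar>" using True by simp
    then have n: "real n \<le> log 2 \<bar>z\<bar>" "log 2 \<bar>z\<bar> \<le> real n + 1"
      unfolding n_def by linarith+
    have "2 ^ n \<le> \<bar>z\<bar>"
      using n(1) True by (subst (asm) le_log_iff) (auto simp: powr_realpow)
    have "\<bar>z\<bar> \<le> 2 powr (real n + 1)"
      using n(2) True by (subst (asm) log_le_iff) auto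
    then have "\<bar>z\<bar> powr \<gamma> \<le> 2 powr ((real n + 1) * \<gamma>)"
      using \<open>0 < \<gamma>\<close> by (subst powr_powr[symmetric]) (intro powr_mono2, auto)
    then have "ennreal (\<bar>z\<bar> powr \<gamma>) \<le>
        ennreal (2 powr ((n + 1) * \<gamma>)) * indicator {z. 2 ^ n \<le> \<bar>z\<bar>} z"
      using \<open>2 ^ n \<le> \<bar>z\<bar>\<close> by (simp add: ennreal_leI add.commute)
    also have "\<dots> \<le> (\<Sum>n. ennreal (2 powr ((n + 1) * \<gamma>)) * indicator {z. 2 ^ n \<le> \<bar>z\<bar>} z)"
      by (rule le_suminf)
    finally show ?thesis by (simp add: add_increasing)
  next
    case False
    then have "\<bar>z\<bar> powr \<gamma> \<le> 1" using \<open>0 < \<gamma>\<close> by (intro powr_le1) auto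
    then have "ennreal (\<bar>z\<bar> powr \<gamma>) \<le> 1" using ennreal_leI by fastforce
    then show ?thesis by (simp add: add_increasing2)
  qed
  have "(\<integral>\<^sup>+z. ennreal (\<bar>z\<bar> powr \<gamma>) \<partial>M) \<le>
      (\<integral>\<^sup>+z. 1 + (\<Sum>n. ennreal (2 powr ((n + 1) * \<gamma>)) * indicator {z. 2 ^ n \<le> \<bar>z\<bar>} z) \<partial>M)"
    by (intro nn_integral_mono pointwise)
  also have "\<dots> = 1 + (\<Sum>n. ennreal (2 powr ((n + 1) * \<gamma>)) * emeasure M {z. 2 ^ n \<le> \<bar>z\<bar>})"
    using emeasure_space_1 by (simp add: nn_integral_add nn_integral_suminf nn_integral_cmult)
  also have "\<dots> \<le> 1 + (\<Sum>n. ennreal (D n))"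
  proof (intro add_left_mono suminf_le allI)
    fix n :: nat
    have "2 powr ((n + 1) * \<gamma>) * measure M {z. 2 ^ n \<le> \<bar>z\<bar>}
        \<le> 2 powr ((n + 1) * \<gamma>) * (C * (2 ^ n) powr (- a))"
      by (intro mult_left_mono tail) auto
    also have "\<dots> = D n"
      by (simp add: D_def powr_realpow[symmetric] powr_powr powr_add[symmetric] algebra_simps)
    finally show "ennreal (2 powr ((n + 1) * \<gamma>)) * emeasure M {z. 2 ^ n \<le> \<bar>z\<bar>} \<le> ennreal (D n)"
      by (simp add: emeasure_eq_measure ennreal_mult'[symmetric] ennreal_leI)
  qed auto
  also have "(\<Sum>n. ennreal (D n)) = ennreal (C * 2 powr \<gamma> / (1 - 2 powr (\<gamma> - a)))"
    using suminf_ennreal_eq[OF \<open>\<And>n. 0 \<le> D n\<close> D] by simp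
  also have "1 + \<dots> = ennreal (1 + C * 2 powr \<gamma> / (1 - 2 powr (\<gamma> - a)))"
    using C \<open>2 powr (\<gamma> - a) < 1\<close> by (subst ennreal_plus) auto
  finally have le: "(\<integral>\<^sup>+z. ennreal (\<bar>z\<bar> powr \<gamma>) \<partial>M) \<le> ennreal (1 + C * 2 powr \<gamma> / (1 - 2 powr (\<gamma> - a)))" .
  show int: "integrable M (\<lambda>z. \<bar>z\<bar> powr \<gamma>)"
    by (rule integrableI_bounded) (use le in \<open>auto intro: le_less_trans\<close>)
  have "ennreal (LINT z|M. \<bar>z\<bar> powr \<gamma>) \<le> ennreal (1 + C * 2 powr \<gamma> / (1 - 2 powr (\<gamma> - a)))"
    using le by (subst nn_integral_eq_integral[symmetric, OF int]) auto
  then show "(LINT z|M. \<bar>z\<bar> powr \<gamma>) \<le> 1 + C * 2 powr \<gamma> / (1 - 2 powr (\<gamma> - a))"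
    using C \<open>2 powr (\<gamma> - a) < 1\<close> by (subst (asm) ennreal_le_iff) auto
qed

lemma gauss_exp_neg_powr_tendsto_0:
  assumes "0 < a"
  shows "(\<lambda>n. (LINT g|gauss. exp (- (\<bar>real n * g\<bar> powr a)))) \<longlonglongrightarrow> 0"
proof -
  have "(\<lambda>n. (LINT g|gauss. exp (- (\<bar>real n * g\<bar> powr a)))) \<longlonglongrightarrow> (LINT g|gauss. (0::real))"
  proof (rule integral_dominated_convergence[where w = "\<lambda>_. 1"])
    have "AE g in gauss. g \<noteq> 0"
      by (subst AE_density) (auto intro: AE_mp[OF AE_lborel_singleton[of "0::real"]])
    then show "AE g in gauss. (\<lambda>n. exp (- (\<bar>real n * g\<bar> powr a))) \<longlonglongrightarrow> 0"
    proof eventually_elim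
      case (elim g)
      have "filterlim (\<lambda>n. \<bar>g\<bar> * real n) at_top sequentially"
        using elim by (intro filterlim_tendsto_pos_mult_at_top[OF tendsto_const] filterlim_real_sequentially) auto
      then have lim: "(\<lambda>n. (\<bar>g\<bar> * real n) powr (- a)) \<longlonglongrightarrow> 0"
        using assms by (intro tendsto_neg_powr) auto
      have le: "exp (- (\<bar>real n * g\<bar> powr a)) \<le> (\<bar>g\<bar> * real n) powr (- a)" if "0 < n" for n
      proof -
        define y where "y = \<bar>real n * g\<bar> powr a"
        have "0 < y" using that elim by (simp add: y_def)
        have "y \<le> exp y" using exp_ge_add_one_self[of y] by linarith
        then have "inverse (exp y) \<le> inverse y"
          using \<open>0 < y\<close> by (rule le_imp_inverse_le)
        then show ?thesis by (simp add: y_def exp_minus powr_minus abs_mult mult.commute)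
      qed
      have "\<forall>\<^sub>F n in sequentially. exp (- (\<bar>real n * g\<bar> powr a)) \<le> (\<bar>g\<bar> * real n) powr (- a)"
        using eventually_gt_at_top[of 0] by (rule eventually_mono) (rule le)
      then show ?case
        by (intro tendsto_sandwich[OF _ _ tendsto_const lim]) simp_all
    qed
  qed auto
  then show ?thesis by simp
qed

lemma concentration_uniform:
  assumes "0 < a" "0 < r"
  obtains d where "0 < d" "\<And>Q \<alpha> b. strictly_stable_law Q \<alpha> b \<Longrightarrow> a \<le> \<alpha> \<Longrightarrow> measure Q {-d..d} \<le> r"
proof -
  have "\<forall>\<^sub>F n in sequentially. (LINT g|gauss. exp (- (\<bar>real n * g\<bar> powr a))) < r / exp (3/2) \<and> 0 < n"
    using order_tendstoD(2)[OF gauss_exp_neg_powr_tendsto_0[OF assms(1)], of "r / exp (3/2)"] assms(2)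
    by (auto intro: eventually_conj eventually_gt_at_top)
  then obtain n :: nat where n: "0 < n" "(LINT g|gauss. exp (- (\<bar>real n * g\<bar> powr a))) < r / exp (3/2)"
    by (metis (mono_tags, lifting) eventually_happens trivial_limit_sequentially)
  show thesis
  proof (rule that)
    show "0 < 1 / real n" using n by simp
    fix Q \<alpha> b assume "strictly_stable_law Q \<alpha> b" and "a \<le> \<alpha>"
    then interpret strictly_stable_law Q \<alpha> b by simp
    define S where "S = distr Q borel (\<lambda>z. real n * z)"
    interpret S: real_distribution S
      unfolding S_def by (rule real_distribution_distr) simp
    have "cmod (char S g) \<le> exp 1 * exp (- (\<bar>real n * g\<bar> powr a))" for g
    proof -
      have "cmod (char S g) = exp (- (\<bar>real n * g\<bar> powr \<alpha>))"
        unfolding S_def by (simp add: char_distr_scale abs_mult powr_mult)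
      also have "\<dots> \<le> exp (1 - \<bar>real n * g\<bar> powr a)"
      proof (cases "\<bar>real n * g\<bar> \<le> 1")
        case True
        then have "\<bar>real n * g\<bar> powr a \<le> 1" using assms by (intro powr_le1) auto
        moreover have "0 \<le> \<bar>real n * g\<bar> powr \<alpha>" by simp
        ultimately show ?thesis unfolding exp_le_cancel_iff by linarith
      next
        case False
        then have "\<bar>real n * g\<bar> powr a \<le> \<bar>real n * g\<bar> powr \<alpha>"
          using \<open>a \<le> \<alpha>\<close> by (intro powr_mono) auto
        then show ?thesis by simp
      qed
      finally show ?thesis by (simp add: exp_diff exp_minus divide_inverse)
    qed
    then have "(LINT g|gauss. cmod (char S g)) \<le> (LINT g|gauss. exp 1 * exp (- (\<bar>real n * g\<bar> powr a)))"
      by (intro integral_mono integrable_norm S.integrable_char_gauss integrable_mult_right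
          gauss.integrable_const_bound[where B = 1]) auto
    also have "\<dots> \<le> exp 1 * (r / exp (3/2))"
      using n(2) by (subst integral_mult_right_zero) (intro mult_left_mono, auto)
    finally have "exp (1/2) * (LINT g|gauss. cmod (char S g)) \<le> exp (1/2) * (exp 1 * (r / exp (3/2)))"
      by (rule mult_left_mono) simp
    also have "exp (1/2) * (exp 1 * (r / exp (3/2))) = r"
      using exp_add[of "1/2" "1::real"] by simp
    finally have "measure S {-1..1} \<le> r" using S.concentration_le by linarith
    moreover have "(\<lambda>z. real n * z) -` {-1..1} = {-(1 / real n)..1 / real n}"
      using n(1) by (auto simp: pos_le_divide_eq pos_minus_divide_le_eq mult.commute)
    then have "measure S {-1..1} = measure Q {-(1 / real n)..1 / real n}"
      unfolding S_def by (simp add: measure_distr)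
    ultimately show "measure Q {-(1 / real n)..1 / real n} \<le> r" by simp
  qed
qed

lemma strictly_stable_uniform_bounds:
  assumes "0 < \<rho>" "\<rho> < 1" "0 < a"
  obtains \<gamma> C \<delta> where "0 < \<gamma>" "\<gamma> \<le> 1" "0 < C" "0 < \<delta>"
    and "\<And>Q \<alpha> b. strictly_stable_law Q \<alpha> b \<Longrightarrow> a \<le> \<alpha> \<Longrightarrow> measure Q {0<..} = \<rho> \<Longrightarrow>
      integrable Q (\<lambda>z. \<bar>z\<bar> powr \<gamma>) \<and> (LINT z|Q. \<bar>z\<bar> powr \<gamma>) \<le> C \<and> \<rho> / 2 \<le> measure Q {\<delta>..}"
proof -
  define \<gamma> where "\<gamma> = min 1 (a / 2)"
  have \<gamma>: "0 < \<gamma>" "\<gamma> \<le> 1" "\<gamma> < a" using \<open>0 < a\<close> by (auto simp: \<gamma>_def)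
  define K where "K = (2 + 3 * gauss_moment) / min \<rho> (1 - \<rho>)"
  define C1 where "C1 = 3 * ((1 + K) * gauss_moment)"
  have "0 \<le> K" using assms gauss_moment_nonneg by (simp add: K_def)
  then have "0 \<le> C1" using gauss_moment_nonneg by (simp add: C1_def)
  define C where "C = 1 + C1 * 2 powr \<gamma> / (1 - 2 powr (\<gamma> - a))"
  have "2 powr (\<gamma> - a) < 1" using \<gamma> by (simp add: powr_less_one)
  with \<open>0 \<le> C1\<close> have "0 < C" unfolding C_def by (intro add_pos_nonneg) auto
  obtain \<delta> where \<delta>: "0 < \<delta>"
    "\<And>Q \<alpha> b. strictly_stable_law Q \<alpha> b \<Longrightarrow> a \<le> \<alpha> \<Longrightarrow> measure Q {-\<delta>..\<delta>} \<le> \<rho> / 2"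
    using concentration_uniform[of a "\<rho> / 2"] assms by auto
  show thesis
  proof (rule that[OF \<gamma>(1,2) \<open>0 < C\<close> \<delta>(1)])
    fix Q \<alpha> b assume Q: "strictly_stable_law Q \<alpha> b" and "a \<le> \<alpha>" and \<rho>: "measure Q {0<..} = \<rho>"
    interpret strictly_stable_law Q \<alpha> b by fact
    have "min \<rho> (1 - \<rho>) * \<bar>b\<bar> \<le> 2 + 3 * gauss_moment"
      using skewness_bound by (simp add: \<rho>)
    then have "\<bar>b\<bar> \<le> K"
      unfolding K_def using assms by (subst pos_le_divide_eq) (auto simp: mult.commute)
    then have C1: "3 * ((1 + \<bar>b\<bar>) * gauss_moment) \<le> C1"
      unfolding C1_def using gauss_moment_nonneg by (intro mult_left_mono mult_right_mono) auto
    have tail: "measure Q {z. x \<le> \<bar>z\<bar>} \<le> C1 * x powr (- a)" if "1 \<le> x" for x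
    proof -
      have "measure Q {z. x \<le> \<bar>z\<bar>} \<le> 3 * ((1 + \<bar>b\<bar>) * gauss_moment) * x powr (- \<alpha>)"
        using that by (intro tail_powr_le) auto
      also have "\<dots> \<le> C1 * x powr (- a)"
        using C1 \<open>0 \<le> C1\<close> that \<open>a \<le> \<alpha>\<close> by (intro mult_mono powr_mono) auto
      finally show ?thesis .
    qed
    have "measure Q {0<..} \<le> measure Q ({-\<delta>..\<delta>} \<union> {\<delta>..})"
      by (intro finite_measure_mono) auto
    also have "\<dots> \<le> measure Q {-\<delta>..\<delta>} + measure Q {\<delta>..}"
      by (intro measure_Un_le) auto
    also have "\<dots> \<le> \<rho> / 2 + measure Q {\<delta>..}"
      using \<delta>(2)[OF Q \<open>a \<le> \<alpha>\<close>] by simp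
    finally show "integrable Q (\<lambda>z. \<bar>z\<bar> powr \<gamma>) \<and> (LINT z|Q. \<bar>z\<bar> powr \<gamma>) \<le> C \<and> \<rho> / 2 \<le> measure Q {\<delta>..}"
      using moment_le_of_tail[OF tail \<gamma>(1,3)] \<rho> by (auto simp: C_def)
  qed
qed

section \<open>Random walks with stable steps and their area\<close>

definition walk :: "(nat \<Rightarrow> real) \<Rightarrow> nat \<Rightarrow> nat \<Rightarrow> real" where
  "walk x k l = (\<Sum>j\<in>{k..<k + l}. x j)"

text \<open>\<open>walk_area m x 0 k\<close> is the Riemann sum \<open>(S\<^sub>1 + \<dots> + S\<^sub>k) / m\<close> of the partial sums \<open>S\<^sub>i = walk x 0 i\<close>.\<close>

definition walk_area :: "nat \<Rightarrow> (nat \<Rightarrow> real) \<Rightarrow> nat \<Rightarrow> nat \<Rightarrow> real" where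
  "walk_area m x k l = (\<Sum>j\<in>{k..<k + l}. real (k + l - j) / real m * x j)"

lemma walk_add: "walk x 0 (k + l) = walk x 0 k + walk x k l"
  unfolding walk_def by (simp add: sum.atLeastLessThan_concat)

lemma walk_area_add:
  "walk_area m x 0 (k + l) = walk_area m x 0 k + real l / real m * walk x 0 k + walk_area m x k l"
proof -
  have "walk_area m x 0 (k + l) =
      (\<Sum>j\<in>{0..<k}. real (k + l - j) / real m * x j) + walk_area m x k l"
    unfolding walk_area_def by (simp add: sum.atLeastLessThan_concat)
  also have "(\<Sum>j\<in>{0..<k}. real (k + l - j) / real m * x j) =
      (\<Sum>j\<in>{0..<k}. real (k - j) / real m * x j + real l / real m * x j)"
    by (intro sum.cong) (auto simp: of_nat_diff add_divide_distrib[symmetric] distrib_right[symmetric])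
  finally show ?thesis
    by (simp add: walk_def walk_area_def sum.distrib sum_distrib_left)
qed

lemma walk_restrict: "{k..<k + l} \<subseteq> J \<Longrightarrow> walk (restrict x J) k l = walk x k l"
  unfolding walk_def by (intro sum.cong) auto

lemma walk_area_restrict: "{k..<k + l} \<subseteq> J \<Longrightarrow> walk_area m (restrict x J) k l = walk_area m x k l"
  unfolding walk_area_def by (intro sum.cong) auto

lemma walk_measurable:
  "{k..<k + l} \<subseteq> J \<Longrightarrow> (\<lambda>x. walk x k l) \<in> borel_measurable (PiM J (\<lambda>_. borel))"
  unfolding walk_def by (intro borel_measurable_sum measurable_component_singleton) auto

lemma walk_area_measurable:
  "{k..<k + l} \<subseteq> J \<Longrightarrow> (\<lambda>x. walk_area m x k l) \<in> borel_measurable (PiM J (\<lambda>_. borel))"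
  unfolding walk_area_def
  by (intro borel_measurable_sum borel_measurable_times borel_measurable_const
      measurable_component_singleton) auto

locale stable_walk = law: strictly_stable_law Q \<alpha> b + prob_space M
  for Q \<alpha> b and M :: "'a measure" +
  fixes \<xi> :: "nat \<Rightarrow> 'a \<Rightarrow> real" and m :: nat
  assumes mesh: "0 < m"
    and indep: "indep_vars (\<lambda>_. borel) \<xi> {..<n}"
    and char_step: "char (distr M borel (\<xi> i)) \<theta> = exp (- (strict_exponent \<alpha> b \<theta> / of_nat m))"
begin

lemma measurable_step [measurable]: "\<xi> i \<in> borel_measurable M"
  using indep[of "Suc i"] by (auto simp: indep_vars_def)

lemma distr_weighted_sum:
  assumes "finite J" "\<And>j. j \<in> J \<Longrightarrow> 0 \<le> c j"
  shows "distr M borel (\<lambda>\<omega>. \<Sum>j\<in>J. c j * \<xi> j \<omega>) =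
    distr Q borel (\<lambda>z. ((\<Sum>j\<in>J. c j powr \<alpha>) / m) powr (1 / \<alpha>) * z)"
proof (rule Levy_uniqueness)
  let ?s = "(\<Sum>j\<in>J. c j powr \<alpha>) / m"
  have "0 \<le> (\<Sum>j\<in>J. c j powr \<alpha>)" by (intro sum_nonneg) auto
  then have s: "(?s powr (1 / \<alpha>)) powr \<alpha> = ?s"
    using law.index by (simp add: powr_powr)
  show "real_distribution (distr M borel (\<lambda>\<omega>. \<Sum>j\<in>J. c j * \<xi> j \<omega>))"
    by (rule real_distribution_distr) simp
  show "real_distribution (distr Q borel (\<lambda>z. ?s powr (1 / \<alpha>) * z))"
    by (rule law.real_distribution_distr) simp
  obtain n where "J \<subseteq> {..<n}"
    using assms(1) finite_nat_iff_bounded by auto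
  have ind: "indep_vars (\<lambda>_. borel) (\<lambda>j \<omega>. c j * \<xi> j \<omega>) J"
    by (rule indep_vars_compose2[OF indep_vars_subset[OF indep \<open>J \<subseteq> {..<n}\<close>]]) simp
  show "char (distr M borel (\<lambda>\<omega>. \<Sum>j\<in>J. c j * \<xi> j \<omega>)) =
      char (distr Q borel (\<lambda>z. ?s powr (1 / \<alpha>) * z))"
  proof
    fix \<theta>
    have "char (distr M borel (\<lambda>\<omega>. c j * \<xi> j \<omega>)) \<theta> =
        exp (- (of_real (c j powr \<alpha>) * (strict_exponent \<alpha> b \<theta> / of_nat m)))" if "j \<in> J" for j
    proof -
      have "char (distr M borel (\<lambda>\<omega>. c j * \<xi> j \<omega>)) \<theta> = char (distr M borel (\<xi> j)) (c j * \<theta>)"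
        by (simp add: char_def integral_distr mult.left_commute mult.commute)
      with assms that show ?thesis by (simp add: char_step strict_exponent_scale)
    qed
    then have "char (distr M borel (\<lambda>\<omega>. \<Sum>j\<in>J. c j * \<xi> j \<omega>)) \<theta> =
        exp (- (of_real ?s * strict_exponent \<alpha> b \<theta>))"
      unfolding char_distr_sum[OF ind] using assms(1)
      by (simp add: exp_sum[symmetric] sum_negf sum_distrib_right sum_divide_distrib)
    also have "\<dots> = char (distr Q borel (\<lambda>z. ?s powr (1 / \<alpha>) * z)) \<theta>"
      by (subst law.char_distr_scale) (auto simp: s)
    finally show "char (distr M borel (\<lambda>\<omega>. \<Sum>j\<in>J. c j * \<xi> j \<omega>)) \<theta> =
      char (distr Q borel (\<lambda>z. ?s powr (1 / \<alpha>) * z)) \<theta>" .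
  qed
qed

lemma measurable_walk [measurable]: "(\<lambda>\<omega>. walk (\<lambda>i. \<xi> i \<omega>) k l) \<in> borel_measurable M"
  unfolding walk_def by measurable

lemma measurable_walk_area [measurable]:
  "(\<lambda>\<omega>. walk_area m (\<lambda>i. \<xi> i \<omega>) k l) \<in> borel_measurable M"
  unfolding walk_area_def by measurable

lemma distr_walk:
  "distr M borel (\<lambda>\<omega>. walk (\<lambda>i. \<xi> i \<omega>) k l) =
    distr Q borel (\<lambda>z. (real l / real m) powr (1 / \<alpha>) * z)"
  using distr_weighted_sum[of "{k..<k + l}" "\<lambda>_. 1"] by (simp add: walk_def)

lemma distr_walk_area:
  assumes "0 < l"
  obtains s where "(1/2) powr (1 + 1 / \<alpha>) * (real l / real m) powr (1 + 1 / \<alpha>) \<le> s"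
    and "s \<le> (real l / real m) powr (1 + 1 / \<alpha>)"
    and "distr M borel (\<lambda>\<omega>. walk_area m (\<lambda>i. \<xi> i \<omega>) k l) = distr Q borel (\<lambda>z. s * z)"
proof
  define h where "h = real l / real m"
  have "0 < h" using assms mesh by (simp add: h_def)
  let ?T = "(\<Sum>j\<in>{k..<k + l}. (real (k + l - j) / real m) powr \<alpha>) / real m"
  show "distr M borel (\<lambda>\<omega>. walk_area m (\<lambda>i. \<xi> i \<omega>) k l) = distr Q borel (\<lambda>z. ?T powr (1 / \<alpha>) * z)"
    using distr_weighted_sum[of "{k..<k + l}" "\<lambda>j. real (k + l - j) / real m"]
    by (simp add: walk_area_def)
  have pow: "(x powr \<alpha> * x) powr (1 / \<alpha>) = x powr (1 + 1 / \<alpha>)" if "0 < x" for x :: real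
    using that law.index by (simp add: powr_mult powr_powr powr_add)
  have "(\<Sum>j\<in>{k..<k + l}. (real (k + l - j) / real m) powr \<alpha>) \<le> (\<Sum>j\<in>{k..<k + l}. h powr \<alpha>)"
    using law.index unfolding h_def by (intro sum_mono powr_mono2 divide_right_mono) auto
  then have "?T \<le> h powr \<alpha> * h"
    using mesh by (simp add: h_def field_simps)
  then have "?T powr (1 / \<alpha>) \<le> (h powr \<alpha> * h) powr (1 / \<alpha>)"
    using law.index by (intro powr_mono2 divide_nonneg_nonneg sum_nonneg) auto
  then show "?T powr (1 / \<alpha>) \<le> (real l / real m) powr (1 + 1 / \<alpha>)"
    using pow[OF \<open>0 < h\<close>] by (simp add: h_def)
  let ?J = "{k..<k + (l + 1) div 2}"
  have "real l / 2 * (h / 2) powr \<alpha> \<le> real (card ?J) * (h / 2) powr \<alpha>"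
    by (intro mult_right_mono) auto
  also have "\<dots> = (\<Sum>j\<in>?J. (h / 2) powr \<alpha>)" by simp
  also have "\<dots> \<le> (\<Sum>j\<in>?J. (real (k + l - j) / real m) powr \<alpha>)"
  proof (intro sum_mono powr_mono2)
    fix j assume "j \<in> ?J"
    then have "l \<le> 2 * (k + l - j)" by auto
    then have "real l / 2 \<le> real (k + l - j)" by linarith
    then have "real l / 2 / real m \<le> real (k + l - j) / real m" by (rule divide_right_mono) simp
    then show "h / 2 \<le> real (k + l - j) / real m" by (simp add: h_def)
  qed (use law.index \<open>0 < h\<close> in auto)
  also have "\<dots> \<le> (\<Sum>j\<in>{k..<k + l}. (real (k + l - j) / real m) powr \<alpha>)"
    using assms by (intro sum_mono2) auto
  finally have "(h / 2) powr \<alpha> * (h / 2) \<le> ?T"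
    using mesh by (simp add: h_def field_simps)
  then have "((h / 2) powr \<alpha> * (h / 2)) powr (1 / \<alpha>) \<le> ?T powr (1 / \<alpha>)"
    using law.index \<open>0 < h\<close> by (intro powr_mono2) auto
  then have "(h / 2) powr (1 + 1 / \<alpha>) \<le> ?T powr (1 / \<alpha>)"
    using pow[of "h / 2"] \<open>0 < h\<close> by simp
  moreover have "(h / 2) powr (1 + 1 / \<alpha>) = (1/2) powr (1 + 1 / \<alpha>) * h powr (1 + 1 / \<alpha>)"
    by (simp add: powr_mult[symmetric])
  ultimately show "(1/2) powr (1 + 1 / \<alpha>) * (real l / real m) powr (1 + 1 / \<alpha>) \<le> ?T powr (1 / \<alpha>)"
    by (simp add: h_def)
qed

lemma past_future_product:
  assumes "I \<inter> J = {}" "finite I" "finite J"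
    and "f \<in> borel_measurable (PiM I (\<lambda>_. borel))" "g \<in> borel_measurable (PiM J (\<lambda>_. borel))"
    and "\<And>x. f (restrict x I) = f x" "\<And>x. g (restrict x J) = g x"
    and int: "integrable M (\<lambda>\<omega>. f (\<lambda>i. \<xi> i \<omega>))" "integrable M (\<lambda>\<omega>. g (\<lambda>i. \<xi> i \<omega>))"
  shows "integrable M (\<lambda>\<omega>. f (\<lambda>i. \<xi> i \<omega>) * g (\<lambda>i. \<xi> i \<omega>) :: real)"
    and "expectation (\<lambda>\<omega>. f (\<lambda>i. \<xi> i \<omega>) * g (\<lambda>i. \<xi> i \<omega>)) =
      expectation (\<lambda>\<omega>. f (\<lambda>i. \<xi> i \<omega>)) * expectation (\<lambda>\<omega>. g (\<lambda>i. \<xi> i \<omega>))"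
proof -
  obtain n where n: "I \<union> J \<subseteq> {..<n}"
    using assms(2,3) finite_nat_iff_bounded[of "I \<union> J"] by auto
  have "indep_var (PiM I (\<lambda>_. borel)) (\<lambda>\<omega>. restrict (\<lambda>i. \<xi> i \<omega>) I)
      (PiM J (\<lambda>_. borel)) (\<lambda>\<omega>. restrict (\<lambda>i. \<xi> i \<omega>) J)"
    using n assms(1) by (intro indep_var_restrict[OF indep[of n]]) auto
  then have "indep_var borel (f \<circ> (\<lambda>\<omega>. restrict (\<lambda>i. \<xi> i \<omega>) I)) borel (g \<circ> (\<lambda>\<omega>. restrict (\<lambda>i. \<xi> i \<omega>) J))"
    using assms by (intro indep_var_compose)
  then have ind: "indep_var borel (\<lambda>\<omega>. f (\<lambda>i. \<xi> i \<omega>)) borel (\<lambda>\<omega>. g (\<lambda>i. \<xi> i \<omega>))"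
    using assms(6,7) by (simp add: comp_def)
  show "integrable M (\<lambda>\<omega>. f (\<lambda>i. \<xi> i \<omega>) * g (\<lambda>i. \<xi> i \<omega>))"
    by (rule indep_var_integrable[OF ind int])
  show "expectation (\<lambda>\<omega>. f (\<lambda>i. \<xi> i \<omega>) * g (\<lambda>i. \<xi> i \<omega>)) =
      expectation (\<lambda>\<omega>. f (\<lambda>i. \<xi> i \<omega>)) * expectation (\<lambda>\<omega>. g (\<lambda>i. \<xi> i \<omega>))"
    by (rule indep_var_lebesgue_integral[OF ind int])
qed

end

lemma powr_add_le:
  fixes x y g :: real
  assumes "0 \<le> x" "0 \<le> y" "0 < g" "g \<le> 1"
  shows "(x + y) powr g \<le> x powr g + y powr g"
proof (cases "x + y = 0")
  case False
  with assms have s: "0 < x + y" by linarith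
  have part: "(x + y) powr g * (u / (x + y)) \<le> u powr g" if "0 \<le> u" "u \<le> x + y" for u
  proof -
    have "u / (x + y) \<le> (u / (x + y)) powr g"
    proof (cases "u = 0")
      case False
      then have "(u / (x + y)) powr 1 \<le> (u / (x + y)) powr g"
        using that s assms by (intro powr_mono') auto
      then show ?thesis using that s by simp
    qed simp
    then have "(x + y) powr g * (u / (x + y)) \<le> (x + y) powr g * (u / (x + y)) powr g"
      by (intro mult_left_mono) auto
    also have "\<dots> = u powr g" using s by (simp add: powr_mult[symmetric])
    finally show ?thesis .
  qed
  have "(x + y) powr g = (x + y) powr g * (x / (x + y)) + (x + y) powr g * (y / (x + y))"
    using s by (simp add: distrib_left[symmetric] add_divide_distrib[symmetric])
  also have "\<dots> \<le> x powr g + y powr g"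
    using assms by (intro add_mono part) auto
  finally show ?thesis .
qed (use assms in auto)

section \<open>The Lyapunov function of the rescaled state\<close>

locale lyapunov = stable_walk Q \<alpha> b M \<xi> m
  for Q \<alpha> b and M :: "'a measure" and \<xi> m +
  fixes \<gamma> C p d v \<eta> :: real and R :: nat
  assumes \<gamma>: "0 < \<gamma>" "\<gamma> \<le> 1"
    and C: "0 < C" and p: "0 < p" "p \<le> 1" and d: "0 < d" and v: "0 < v" and \<eta>: "0 < \<eta>"
    and moment: "integrable Q (\<lambda>z. \<bar>z\<bar> powr \<gamma>)" "(LINT z|Q. \<bar>z\<bar> powr \<gamma>) \<le> C"
    and positive: "p \<le> measure Q {d / (1/2) powr (1 + 1 / \<alpha>)..}"
    and \<eta>_C: "\<eta> * (2 * C) \<le> p / 8" and v_large: "3 * p \<le> \<eta> * v powr \<gamma>"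
    and R: "2 \<le> R" and contraction: "2 * (1 / real R) powr (\<gamma> / \<alpha>) \<le> 1/4"
    and jump_large: "real R * v + 1 \<le> d * (real R - 1) powr (1 + 1 / \<alpha>)"
begin

definition scale :: "nat \<Rightarrow> real" where "scale n = real R ^ n"

definition steps :: "nat \<Rightarrow> nat" where "steps n = m * R ^ n"

definition blocklen :: "nat \<Rightarrow> nat" where "blocklen n = m * (R - 1) * R ^ n"

definition blocktime :: "nat \<Rightarrow> real" where "blocktime n = (real R - 1) * scale n"

lemma steps_Suc: "steps (Suc n) = steps n + blocklen n"
  unfolding steps_def blocklen_def using R by (cases R) (simp_all add: algebra_simps)

lemma steps_mono: "i \<le> j \<Longrightarrow> steps i \<le> steps j"
  using R by (simp add: steps_def power_increasing)

lemma blocklen_pos: "0 < blocklen n"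
  using R mesh by (simp add: blocklen_def)

lemma scale_ge_1: "1 \<le> scale n"
  using R by (simp add: scale_def)

lemma scale_Suc: "scale (Suc n) = real R * scale n"
  by (simp add: scale_def)

lemma blocktime_pos: "0 < blocktime n"
  using R scale_ge_1[of n] by (simp add: blocktime_def)

lemma blocktime_eq: "real (blocklen n) / real m = blocktime n"
  using R mesh by (simp add: blocklen_def blocktime_def scale_def of_nat_diff)

definition level :: "(nat \<Rightarrow> real) \<Rightarrow> nat \<Rightarrow> real" where
  "level x n = walk x 0 (steps n)"

definition area :: "(nat \<Rightarrow> real) \<Rightarrow> nat \<Rightarrow> real" where
  "area x n = walk_area m x 0 (steps n)"

definition dlevel :: "(nat \<Rightarrow> real) \<Rightarrow> nat \<Rightarrow> real" where
  "dlevel x n = walk x (steps n) (blocklen n)"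

definition darea :: "(nat \<Rightarrow> real) \<Rightarrow> nat \<Rightarrow> real" where
  "darea x n = walk_area m x (steps n) (blocklen n)"

lemma level_Suc: "level x (Suc n) = level x n + dlevel x n"
  by (simp add: level_def dlevel_def steps_Suc walk_add)

lemma area_Suc: "area x (Suc n) = area x n + blocktime n * level x n + darea x n"
  by (simp add: area_def darea_def level_def steps_Suc walk_area_add blocktime_eq)

definition size :: "(nat \<Rightarrow> real) \<Rightarrow> nat \<Rightarrow> real" where
  "size x n = \<bar>level x n\<bar> / scale n powr (1 / \<alpha>) + \<bar>area x n\<bar> / scale n powr (1 + 1 / \<alpha>)"

definition rlevel :: "(nat \<Rightarrow> real) \<Rightarrow> nat \<Rightarrow> real" where
  "rlevel x n = \<bar>dlevel x n\<bar> / blocktime n powr (1 / \<alpha>)"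

definition rarea :: "(nat \<Rightarrow> real) \<Rightarrow> nat \<Rightarrow> real" where
  "rarea x n = \<bar>darea x n\<bar> / blocktime n powr (1 + 1 / \<alpha>)"

lemma size_nonneg: "0 \<le> size x n" and rlevel_nonneg: "0 \<le> rlevel x n" and rarea_nonneg: "0 \<le> rarea x n"
  by (simp_all add: size_def rlevel_def rarea_def)

lemma size_Suc_le:
  "size x (Suc n) \<le> 2 * (1 / real R) powr (1 / \<alpha>) * size x n + (rlevel x n + rarea x n)"
proof -
  define a where "a = 1 / \<alpha>"
  have a: "0 < a" using law.index by (simp add: a_def)
  define t where "t = scale n"
  define h where "h = blocktime n"
  define r where "r = (1 / real R) powr a"
  have t: "0 < t" and h: "0 < h" and r: "0 \<le> r" and ht: "h \<le> real R * t"
    using scale_ge_1[of n] blocktime_pos[of n] R by (auto simp: t_def h_def r_def blocktime_def)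
  have Rt: "(real R * t) powr a = t powr a / r"
    using R t by (simp add: r_def powr_mult powr_divide)
  have "r \<noteq> 0" using R by (simp add: r_def)
  have Rt1: "(real R * t) powr (1 + a) = real R * t * (t powr a / r)"
    using R t Rt by (simp add: powr_add)
  have ta: "t powr (1 + a) = t * t powr a" using t by (simp add: powr_add)
  have "\<bar>level x (Suc n)\<bar> / (real R * t) powr a
      \<le> \<bar>level x n\<bar> / (real R * t) powr a + \<bar>dlevel x n\<bar> / (real R * t) powr a"
    unfolding level_Suc add_divide_distrib[symmetric] by (intro divide_right_mono) auto
  also have "\<dots> \<le> r * (\<bar>level x n\<bar> / t powr a) + \<bar>dlevel x n\<bar> / h powr a"
  proof (intro add_mono)
    show "\<bar>level x n\<bar> / (real R * t) powr a \<le> r * (\<bar>level x n\<bar> / t powr a)"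
      by (simp only: Rt) (simp add: mult.commute)
    show "\<bar>dlevel x n\<bar> / (real R * t) powr a \<le> \<bar>dlevel x n\<bar> / h powr a"
      using ht h a t R by (intro divide_left_mono powr_mono2) auto
  qed
  finally have 1: "\<bar>level x (Suc n)\<bar> / (real R * t) powr a
      \<le> r * (\<bar>level x n\<bar> / t powr a) + \<bar>dlevel x n\<bar> / h powr a" .
  have "\<bar>area x (Suc n)\<bar> \<le> \<bar>area x n\<bar> + h * \<bar>level x n\<bar> + \<bar>darea x n\<bar>"
  proof -
    have "\<bar>h * level x n\<bar> = h * \<bar>level x n\<bar>" using h by (simp add: abs_mult)
    then show ?thesis unfolding area_Suc h_def[symmetric] by linarith
  qed
  then have "\<bar>area x (Suc n)\<bar> / (real R * t) powr (1 + a)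
      \<le> \<bar>area x n\<bar> / (real R * t) powr (1 + a) + h * \<bar>level x n\<bar> / (real R * t) powr (1 + a)
        + \<bar>darea x n\<bar> / (real R * t) powr (1 + a)"
    unfolding add_divide_distrib[symmetric] by (intro divide_right_mono) auto
  also have "\<dots> \<le> r * (\<bar>area x n\<bar> / t powr (1 + a)) + r * (\<bar>level x n\<bar> / t powr a)
        + \<bar>darea x n\<bar> / h powr (1 + a)"
  proof (intro add_mono)
    have "\<bar>area x n\<bar> / (real R * t) powr (1 + a) = (1 / real R) * (r * (\<bar>area x n\<bar> / t powr (1 + a)))"
      unfolding Rt1 ta using t \<open>r \<noteq> 0\<close> by (simp add: field_simps)
    also have "\<dots> \<le> 1 * (r * (\<bar>area x n\<bar> / t powr (1 + a)))"
      using R r by (intro mult_right_mono) auto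
    finally show "\<bar>area x n\<bar> / (real R * t) powr (1 + a) \<le> r * (\<bar>area x n\<bar> / t powr (1 + a))"
      by simp
    have "h * \<bar>level x n\<bar> / (real R * t) powr (1 + a) = (h / (real R * t)) * (r * (\<bar>level x n\<bar> / t powr a))"
      unfolding Rt1 using t \<open>r \<noteq> 0\<close> by (simp add: field_simps)
    also have "\<dots> \<le> 1 * (r * (\<bar>level x n\<bar> / t powr a))"
      using R r ht t by (intro mult_right_mono) auto
    finally show "h * \<bar>level x n\<bar> / (real R * t) powr (1 + a) \<le> r * (\<bar>level x n\<bar> / t powr a)"
      by simp
    show "\<bar>darea x n\<bar> / (real R * t) powr (1 + a) \<le> \<bar>darea x n\<bar> / h powr (1 + a)"
      using ht h a t R by (intro divide_left_mono powr_mono2) auto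
  qed
  finally have 2: "\<bar>area x (Suc n)\<bar> / (real R * t) powr (1 + a)
      \<le> r * (\<bar>area x n\<bar> / t powr (1 + a)) + r * (\<bar>level x n\<bar> / t powr a)
        + \<bar>darea x n\<bar> / h powr (1 + a)" .
  have "0 \<le> r * (\<bar>area x n\<bar> / t powr (1 + a))" using r by simp
  with 1 2 show ?thesis
    unfolding size_def rlevel_def rarea_def scale_Suc a_def[symmetric] t_def[symmetric]
      h_def[symmetric] r_def[symmetric]
    by (simp only: distrib_left mult.assoc) argo
qed

lemma size_Suc_powr_le:
  "size x (Suc n) powr \<gamma> \<le> 2 * (1 / real R) powr (\<gamma> / \<alpha>) * size x n powr \<gamma>
    + (rlevel x n powr \<gamma> + rarea x n powr \<gamma>)"
proof -
  let ?r = "(1 / real R) powr (1 / \<alpha>)"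
  have "size x (Suc n) powr \<gamma> \<le> (2 * ?r * size x n + (rlevel x n + rarea x n)) powr \<gamma>"
    using size_Suc_le \<gamma> size_nonneg by (intro powr_mono2) auto
  also have "\<dots> \<le> (2 * ?r * size x n) powr \<gamma> + (rlevel x n + rarea x n) powr \<gamma>"
    using \<gamma> size_nonneg rlevel_nonneg rarea_nonneg by (intro powr_add_le) auto
  also have "\<dots> \<le> 2 * (1 / real R) powr (\<gamma> / \<alpha>) * size x n powr \<gamma> + (rlevel x n powr \<gamma> + rarea x n powr \<gamma>)"
  proof (intro add_mono)
    have "(2 * ?r * size x n) powr \<gamma> = 2 powr \<gamma> * (1 / real R) powr (\<gamma> / \<alpha>) * size x n powr \<gamma>"
      by (simp add: powr_mult powr_powr)
    also have "\<dots> \<le> 2 * (1 / real R) powr (\<gamma> / \<alpha>) * size x n powr \<gamma>"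
      using \<gamma> powr_mono[of \<gamma> 1 2] by (intro mult_right_mono) auto
    finally show "(2 * ?r * size x n) powr \<gamma> \<le> 2 * (1 / real R) powr (\<gamma> / \<alpha>) * size x n powr \<gamma>" .
    show "(rlevel x n + rarea x n) powr \<gamma> \<le> rlevel x n powr \<gamma> + rarea x n powr \<gamma>"
      using \<gamma> rlevel_nonneg rarea_nonneg by (intro powr_add_le) auto
  qed
  finally show ?thesis .
qed

definition big_block :: "(nat \<Rightarrow> real) \<Rightarrow> nat \<Rightarrow> bool" where
  "big_block x n \<longleftrightarrow> d * blocktime n powr (1 + 1 / \<alpha>) \<le> darea x n"

lemma area_Suc_ge_1:
  assumes "size x n \<le> v" "big_block x n"
  shows "1 \<le> area x (Suc n)"
proof -
  define a where "a = 1 / \<alpha>"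
  define t where "t = scale n"
  have t: "1 \<le> t" unfolding t_def by (rule scale_ge_1)
  have a: "0 < a" using law.index by (simp add: a_def)
  have ta: "t powr (1 + a) = t * t powr a" using t by (simp add: powr_add)
  define u where "u = \<bar>level x n\<bar> / t powr a"
  define w where "w = \<bar>area x n\<bar> / t powr (1 + a)"
  have uw: "0 \<le> u" "0 \<le> w" "u + w \<le> v"
    using assms(1) by (auto simp: u_def w_def size_def t_def a_def)
  have lev: "\<bar>level x n\<bar> = u * t powr a" and ar: "\<bar>area x n\<bar> = w * t powr (1 + a)"
    using t by (simp_all add: u_def w_def)
  have "1 * 1 \<le> t * t powr a"
    using t a by (intro mult_mono ge_one_powr_ge_zero) auto
  then have one: "1 \<le> t powr (1 + a)" by (simp add: ta)
  have "w + (real R - 1) * u \<le> real R * (u + w)"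
  proof -
    have "0 \<le> (real R - 1) * w" using uw R by (intro mult_nonneg_nonneg) auto
    then show ?thesis using uw by (simp add: algebra_simps)
  qed
  also have "\<dots> \<le> real R * v" using uw by (intro mult_left_mono) auto
  finally have neg: "w + (real R - 1) * u \<le> real R * v" .
  have "1 \<le> t powr (1 + a) * (d * (real R - 1) powr (1 + a) - real R * v)"
    using mult_mono[OF one, of 1 "d * (real R - 1) powr (1 + a) - real R * v"] jump_large
    by (simp add: a_def)
  also have "\<dots> \<le> t powr (1 + a) * (d * (real R - 1) powr (1 + a) - (w + (real R - 1) * u))"
    using neg by (intro mult_left_mono) auto
  also have "\<dots> = d * blocktime n powr (1 + a) - \<bar>area x n\<bar> - blocktime n * \<bar>level x n\<bar>"
  proof -
    have "blocktime n powr (1 + a) = (real R - 1) powr (1 + a) * t powr (1 + a)"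
      unfolding blocktime_def t_def by (rule powr_mult)
    then show ?thesis
      unfolding lev ar by (simp add: blocktime_def t_def[symmetric] ta algebra_simps)
  qed
  also have "\<dots> \<le> darea x n + area x n + blocktime n * level x n"
  proof -
    have "- (blocktime n * \<bar>level x n\<bar>) \<le> blocktime n * level x n"
      using mult_left_mono[of "- \<bar>level x n\<bar>" "level x n" "blocktime n"] blocktime_pos[of n] by simp
    then show ?thesis using assms(2) unfolding big_block_def a_def by linarith
  qed
  finally show ?thesis by (simp add: area_Suc)
qed

definition surviving :: "(nat \<Rightarrow> real) \<Rightarrow> nat \<Rightarrow> bool" where
  "surviving x n \<longleftrightarrow> (\<forall>j\<le>n. area x j < 1)"

lemma surviving_Suc: "surviving x (Suc n) \<Longrightarrow> surviving x n \<and> \<not> (size x n \<le> v \<and> big_block x n)"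
  using area_Suc_ge_1[of x n] by (force simp: surviving_def)

definition lyap :: "(nat \<Rightarrow> real) \<Rightarrow> nat \<Rightarrow> real" where
  "lyap x n = of_bool (surviving x n) * (1 + \<eta> * size x n powr \<gamma>)"

definition ctr :: real where "ctr = 2 * (1 / real R) powr (\<gamma> / \<alpha>)"

lemma lyap_Suc_le:
  "lyap x (Suc n) \<le> of_bool (surviving x n \<and> size x n \<le> v) * of_bool (\<not> big_block x n)
    + of_bool (surviving x n) * (of_bool (v < size x n) + \<eta> * ctr * size x n powr \<gamma>)
    + \<eta> * (of_bool (surviving x n) * (rlevel x n powr \<gamma>) + of_bool (surviving x n) * (rarea x n powr \<gamma>))"
proof (cases "surviving x (Suc n)")
  case True
  have "\<eta> * size x (Suc n) powr \<gamma> \<le> \<eta> * (ctr * size x n powr \<gamma> + (rlevel x n powr \<gamma> + rarea x n powr \<gamma>))"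
    using \<eta> size_Suc_powr_le[of x n] unfolding ctr_def by (intro mult_left_mono) auto
  with True surviving_Suc[OF True] show ?thesis
    by (cases "size x n \<le> v") (simp_all add: lyap_def algebra_simps)
next
  case False
  then show ?thesis using \<eta> by (simp add: lyap_def ctr_def)
qed

lemma drift:
  "of_bool (s \<le> v) * (1 - p) + (of_bool (v < s) + \<eta> * ctr * s powr \<gamma>) + \<eta> * (2 * C)
    \<le> (1 - p / 2) * (1 + \<eta> * s powr \<gamma>)"
proof -
  have ctr: "0 \<le> ctr" "ctr \<le> 1/4" using contraction by (simp_all add: ctr_def)
  define y where "y = \<eta> * s powr \<gamma>"
  have y: "0 \<le> y" using \<eta> by (simp add: y_def)
  have cy: "ctr * y \<le> 1/4 * y" using ctr y by (intro mult_right_mono) auto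
  have py: "p * y \<le> 1 * y" using p y by (intro mult_right_mono) auto
  have *: "\<eta> * ctr * s powr \<gamma> = ctr * y" by (simp add: y_def)
  have e: "(1 - p / 2) * (1 + y) = 1 - p / 2 + y - p * y / 2"
    by (simp add: algebra_simps)
  have "of_bool (s \<le> v) * (1 - p) + (of_bool (v < s) + ctr * y) + \<eta> * (2 * C)
    \<le> (1 - p / 2) * (1 + y)"
  proof (cases "s \<le> v")
    case True
    then have "of_bool (s \<le> v) = (1::real)" "of_bool (v < s) = (0::real)" by simp_all
    then show ?thesis using cy py y \<eta>_C p unfolding e by (simp only:) argo
  next
    case False
    then have "\<eta> * v powr \<gamma> \<le> y"
      unfolding y_def using \<eta> \<gamma> v by (intro mult_left_mono powr_mono2) auto
    moreover have "of_bool (s \<le> v) = (0::real)" "of_bool (v < s) = (1::real)"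
      using False by simp_all
    ultimately show ?thesis using cy py y \<eta>_C p v_large unfolding e by (simp only:)
  qed
  then show ?thesis by (simp only: * y_def)
qed

end

context lyapunov
begin

abbreviation path :: "'a \<Rightarrow> nat \<Rightarrow> real" where "path \<omega> \<equiv> \<lambda>i. \<xi> i \<omega>"

lemma measurable_level [measurable]: "(\<lambda>\<omega>. level (path \<omega>) n) \<in> borel_measurable M"
  and measurable_area [measurable]: "(\<lambda>\<omega>. area (path \<omega>) n) \<in> borel_measurable M"
  and measurable_dlevel [measurable]: "(\<lambda>\<omega>. dlevel (path \<omega>) n) \<in> borel_measurable M"
  and measurable_darea [measurable]: "(\<lambda>\<omega>. darea (path \<omega>) n) \<in> borel_measurable M"
  unfolding level_def area_def dlevel_def darea_def by measurable

lemma measurable_size [measurable]: "(\<lambda>\<omega>. size (path \<omega>) n) \<in> borel_measurable M"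
  and measurable_rlevel [measurable]: "(\<lambda>\<omega>. rlevel (path \<omega>) n) \<in> borel_measurable M"
  and measurable_rarea [measurable]: "(\<lambda>\<omega>. rarea (path \<omega>) n) \<in> borel_measurable M"
  and measurable_big_block [measurable]: "Measurable.pred M (\<lambda>\<omega>. big_block (path \<omega>) n)"
  and measurable_surviving [measurable]: "Measurable.pred M (\<lambda>\<omega>. surviving (path \<omega>) n)"
  unfolding size_def rlevel_def rarea_def big_block_def surviving_def by measurable

lemma moment_of_scaled_law:
  assumes X: "X \<in> borel_measurable M" and distr: "distr M borel X = distr Q borel (\<lambda>z. s * z)"
    and "0 \<le> s" "s \<le> c" "0 < c"
  shows "integrable M (\<lambda>\<omega>. (\<bar>X \<omega>\<bar> / c) powr \<gamma>)" "expectation (\<lambda>\<omega>. (\<bar>X \<omega>\<bar> / c) powr \<gamma>) \<le> C"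
proof -
  let ?f = "\<lambda>z. (\<bar>z\<bar> / c) powr \<gamma>"
  have eq: "?f (s * z) = (s / c) powr \<gamma> * \<bar>z\<bar> powr \<gamma>" for z
    using assms by (simp add: abs_mult powr_mult[symmetric] field_simps)
  have "integrable Q (\<lambda>z. ?f (s * z))"
    unfolding eq using moment(1) by simp
  then have "integrable (distr M borel X) ?f"
    unfolding distr by (subst integrable_distr_eq) auto
  then show "integrable M (\<lambda>\<omega>. ?f (X \<omega>))"
    using X by (subst (asm) integrable_distr_eq) auto
  have "expectation (\<lambda>\<omega>. ?f (X \<omega>)) = (LINT z|distr M borel X. ?f z)"
    using X by (subst integral_distr) auto
  also have "\<dots> = (s / c) powr \<gamma> * (LINT z|Q. \<bar>z\<bar> powr \<gamma>)"
    unfolding distr by (subst integral_distr) (auto simp: eq)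
  also have "\<dots> \<le> 1 * C"
  proof (intro mult_mono moment(2))
    show "(s / c) powr \<gamma> \<le> 1" using assms \<gamma> by (intro powr_le1) auto
  qed (auto intro: integral_nonneg_AE)
  finally show "expectation (\<lambda>\<omega>. ?f (X \<omega>)) \<le> C" by simp
qed

lemma walk_moment:
  assumes "0 < l"
  shows "integrable M (\<lambda>\<omega>. (\<bar>walk (path \<omega>) k l\<bar> / (real l / real m) powr (1 / \<alpha>)) powr \<gamma>)"
    and "expectation (\<lambda>\<omega>. (\<bar>walk (path \<omega>) k l\<bar> / (real l / real m) powr (1 / \<alpha>)) powr \<gamma>) \<le> C"
  by (rule moment_of_scaled_law[OF _ distr_walk]; use assms mesh in simp)+

lemma walk_area_moment:
  assumes "0 < l"
  shows "integrable M (\<lambda>\<omega>. (\<bar>walk_area m (path \<omega>) k l\<bar> / (real l / real m) powr (1 + 1 / \<alpha>)) powr \<gamma>)"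
    and "expectation (\<lambda>\<omega>. (\<bar>walk_area m (path \<omega>) k l\<bar> / (real l / real m) powr (1 + 1 / \<alpha>)) powr \<gamma>) \<le> C"
proof -
  obtain s where s: "(1/2) powr (1 + 1 / \<alpha>) * (real l / real m) powr (1 + 1 / \<alpha>) \<le> s"
    "s \<le> (real l / real m) powr (1 + 1 / \<alpha>)"
    and distr: "distr M borel (\<lambda>\<omega>. walk_area m (path \<omega>) k l) = distr Q borel (\<lambda>z. s * z)"
    using distr_walk_area[OF assms] by blast
  have "0 \<le> s" using order_trans[OF _ s(1)] by simp
  note * = moment_of_scaled_law[OF measurable_walk_area distr \<open>0 \<le> s\<close> s(2)]
  show "integrable M (\<lambda>\<omega>. (\<bar>walk_area m (path \<omega>) k l\<bar> / (real l / real m) powr (1 + 1 / \<alpha>)) powr \<gamma>)"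
    using assms mesh by (intro *(1)) simp
  show "expectation (\<lambda>\<omega>. (\<bar>walk_area m (path \<omega>) k l\<bar> / (real l / real m) powr (1 + 1 / \<alpha>)) powr \<gamma>) \<le> C"
    using assms mesh by (intro *(2)) simp
qed

lemma rlevel_moment: "integrable M (\<lambda>\<omega>. rlevel (path \<omega>) n powr \<gamma>)"
  "expectation (\<lambda>\<omega>. rlevel (path \<omega>) n powr \<gamma>) \<le> C"
  using walk_moment[OF blocklen_pos] by (simp_all add: rlevel_def dlevel_def blocktime_eq)

lemma rarea_moment: "integrable M (\<lambda>\<omega>. rarea (path \<omega>) n powr \<gamma>)"
  "expectation (\<lambda>\<omega>. rarea (path \<omega>) n powr \<gamma>) \<le> C"
  using walk_area_moment[OF blocklen_pos] by (simp_all add: rarea_def darea_def blocktime_eq)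

lemma size_0_moment:
  "integrable M (\<lambda>\<omega>. size (path \<omega>) 0 powr \<gamma>)" "expectation (\<lambda>\<omega>. size (path \<omega>) 0 powr \<gamma>) \<le> 2 * C"
proof -
  have le: "size x 0 powr \<gamma> \<le> \<bar>walk x 0 m\<bar> powr \<gamma> + \<bar>walk_area m x 0 m\<bar> powr \<gamma>" for x
    using powr_add_le[of "\<bar>walk x 0 m\<bar>" "\<bar>walk_area m x 0 m\<bar>" \<gamma>] \<gamma>
    by (simp add: size_def level_def area_def steps_def scale_def)
  have int: "integrable M (\<lambda>\<omega>. \<bar>walk (path \<omega>) 0 m\<bar> powr \<gamma>)"
    "integrable M (\<lambda>\<omega>. \<bar>walk_area m (path \<omega>) 0 m\<bar> powr \<gamma>)"
    using walk_moment(1)[OF mesh, of 0] walk_area_moment(1)[OF mesh, of 0] mesh by simp_all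
  show i: "integrable M (\<lambda>\<omega>. size (path \<omega>) 0 powr \<gamma>)"
    by (rule Bochner_Integration.integrable_bound[OF Bochner_Integration.integrable_add[OF int]]) (use le in auto)
  have "expectation (\<lambda>\<omega>. size (path \<omega>) 0 powr \<gamma>) \<le>
      expectation (\<lambda>\<omega>. \<bar>walk (path \<omega>) 0 m\<bar> powr \<gamma> + \<bar>walk_area m (path \<omega>) 0 m\<bar> powr \<gamma>)"
    using i int le by (intro integral_mono) auto
  also have "\<dots> \<le> C + C"
    using int walk_moment(2)[OF mesh, of 0] walk_area_moment(2)[OF mesh, of 0] mesh
    by simp
  finally show "expectation (\<lambda>\<omega>. size (path \<omega>) 0 powr \<gamma>) \<le> 2 * C" by simp
qed

lemma size_moment: "integrable M (\<lambda>\<omega>. size (path \<omega>) n powr \<gamma>)"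
proof (induction n)
  case (Suc n)
  show ?case
    by (rule Bochner_Integration.integrable_bound[OF Bochner_Integration.integrable_add[OF
          integrable_mult_right[OF Suc, of "2 * (1 / real R) powr (\<gamma> / \<alpha>)"]
          Bochner_Integration.integrable_add[OF rlevel_moment(1)[of n] rarea_moment(1)[of n]]]])
      (use size_Suc_powr_le in \<open>auto simp: add.assoc\<close>)
qed (rule size_0_moment)

lemma prob_eq_expectation_of_bool:
  assumes "Measurable.pred M P"
  shows "measure M {\<omega> \<in> space M. P \<omega>} = expectation (\<lambda>\<omega>. of_bool (P \<omega>))"
proof -
  have "expectation (\<lambda>\<omega>. of_bool (P \<omega>)) = (expectation (indicator {\<omega> \<in> space M. P \<omega>}) :: real)"
    by (intro Bochner_Integration.integral_cong) (auto simp: indicator_def)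
  then show ?thesis by (simp add: Int_absorb2)
qed

lemma big_block_prob: "p \<le> expectation (\<lambda>\<omega>. of_bool (big_block (path \<omega>) n))"
proof -
  have l: "0 < blocklen n" by (rule blocklen_pos)
  let ?h = "blocktime n powr (1 + 1 / \<alpha>)"
  obtain s where s: "(1/2) powr (1 + 1 / \<alpha>) * ?h \<le> s"
    and distr: "distr M borel (\<lambda>\<omega>. darea (path \<omega>) n) = distr Q borel (\<lambda>z. s * z)"
    using distr_walk_area[OF l, of "steps n"] unfolding blocktime_eq darea_def by blast
  let ?e = "d / (1/2) powr (1 + 1 / \<alpha>)"
  have "p \<le> measure Q {?e..}" by (rule positive)
  also have "\<dots> \<le> measure Q ((\<lambda>z. s * z) -` {d * ?h..})"
  proof (intro law.finite_measure_mono subsetI)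
    fix z assume "z \<in> {?e..}"
    then have "((1/2) powr (1 + 1 / \<alpha>) * ?h) * ?e \<le> s * z"
      using s d order_trans[OF _ s] by (intro mult_mono) auto
    then show "z \<in> (\<lambda>z. s * z) -` {d * ?h..}" by (simp add: mult.commute)
  next
    have "(\<lambda>z. s * z) \<in> borel_measurable borel" by measurable
    from measurable_sets_borel[OF this, of "{d * ?h..}"]
    show "(\<lambda>z. s * z) -` {d * ?h..} \<in> sets Q" by simp
  qed
  also have "\<dots> = measure (distr Q borel (\<lambda>z. s * z)) {d * ?h..}"
    by (simp add: measure_distr)
  also have "\<dots> = measure M {\<omega> \<in> space M. big_block (path \<omega>) n}"
    unfolding distr[symmetric]
    by (simp add: measure_distr) (simp add: big_block_def vimage_def Int_def conj_commute)
  also have "\<dots> = expectation (\<lambda>\<omega>. of_bool (big_block (path \<omega>) n))"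
    by (rule prob_eq_expectation_of_bool) measurable
  finally show ?thesis .
qed

abbreviation past :: "nat \<Rightarrow> (nat \<Rightarrow> real) measure" where
  "past n \<equiv> PiM {0..<steps n} (\<lambda>_. borel)"

abbreviation block :: "nat \<Rightarrow> (nat \<Rightarrow> real) measure" where
  "block n \<equiv> PiM {steps n..<steps (Suc n)} (\<lambda>_. borel)"

lemma past_measurable [measurable]:
  "j \<le> n \<Longrightarrow> (\<lambda>x. level x j) \<in> borel_measurable (past n)"
  "j \<le> n \<Longrightarrow> (\<lambda>x. area x j) \<in> borel_measurable (past n)"
  using steps_mono[of j n] unfolding level_def area_def
  by (auto intro!: walk_measurable walk_area_measurable)

lemma past_restrict:
  assumes "j \<le> n"
  shows "level (restrict x {0..<steps n}) j = level x j" "area (restrict x {0..<steps n}) j = area x j"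
  using steps_mono[OF assms] unfolding level_def area_def
  by (simp_all add: walk_restrict walk_area_restrict)

lemma block_measurable [measurable]:
  "(\<lambda>x. dlevel x n) \<in> borel_measurable (block n)" "(\<lambda>x. darea x n) \<in> borel_measurable (block n)"
  unfolding dlevel_def darea_def by (auto intro!: walk_measurable walk_area_measurable simp: steps_Suc)

lemma block_restrict:
  "dlevel (restrict x {steps n..<steps (Suc n)}) n = dlevel x n"
  "darea (restrict x {steps n..<steps (Suc n)}) n = darea x n"
  unfolding dlevel_def darea_def by (simp_all add: walk_restrict walk_area_restrict steps_Suc)

lemma past_functions:
  "(\<lambda>x. of_bool (surviving x n) :: real) \<in> borel_measurable (past n)"
  "(\<lambda>x. of_bool (surviving x n \<and> size x n \<le> v) :: real) \<in> borel_measurable (past n)"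
  "surviving (restrict x {0..<steps n}) n = surviving x n"
  "size (restrict x {0..<steps n}) n = size x n"
proof -
  have [measurable]: "Measurable.pred (past n) (\<lambda>x. surviving x n)"
    unfolding surviving_def by measurable
  have [measurable]: "(\<lambda>x. size x n) \<in> borel_measurable (past n)"
    unfolding size_def by measurable
  show "(\<lambda>x. of_bool (surviving x n) :: real) \<in> borel_measurable (past n)"
    "(\<lambda>x. of_bool (surviving x n \<and> size x n \<le> v) :: real) \<in> borel_measurable (past n)"
    by measurable
qed (simp_all add: surviving_def size_def past_restrict)

lemma block_functions:
  "(\<lambda>x. rlevel x n powr \<gamma>) \<in> borel_measurable (block n)"
  "(\<lambda>x. rarea x n powr \<gamma>) \<in> borel_measurable (block n)"
  "(\<lambda>x. of_bool (\<not> big_block x n) :: real) \<in> borel_measurable (block n)"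
  unfolding rlevel_def rarea_def big_block_def by measurable

lemma past_block_product:
  assumes "f \<in> borel_measurable (past n)" "g \<in> borel_measurable (block n)"
    and "\<And>x. f (restrict x {0..<steps n}) = f x" "\<And>x. g (restrict x {steps n..<steps (Suc n)}) = g x"
    and "integrable M (\<lambda>\<omega>. f (path \<omega>))" "integrable M (\<lambda>\<omega>. g (path \<omega>))"
  shows "integrable M (\<lambda>\<omega>. f (path \<omega>) * g (path \<omega>) :: real)"
    and "expectation (\<lambda>\<omega>. f (path \<omega>) * g (path \<omega>)) =
      expectation (\<lambda>\<omega>. f (path \<omega>)) * expectation (\<lambda>\<omega>. g (path \<omega>))"
  using past_future_product[OF _ _ _ assms] by auto

lemma integrable_of_bool [intro]:
  "Measurable.pred M P \<Longrightarrow> integrable M (\<lambda>\<omega>. of_bool (P \<omega>) :: real)"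
  by (rule integrable_const_bound[where B = 1]) auto

lemma integrable_lyap: "integrable M (\<lambda>\<omega>. lyap (path \<omega>) n)"
proof (rule Bochner_Integration.integrable_bound)
  show "integrable M (\<lambda>\<omega>. 1 + \<eta> * size (path \<omega>) n powr \<gamma>)"
    by (intro Bochner_Integration.integrable_add integrable_mult_right size_moment) simp
qed (use \<eta> in \<open>auto simp: lyap_def\<close>)

lemma expectation_lyap_Suc:
  "expectation (\<lambda>\<omega>. lyap (path \<omega>) (Suc n)) \<le> (1 - p / 2) * expectation (\<lambda>\<omega>. lyap (path \<omega>) n)"
proof -
  let ?s = "\<lambda>\<omega>. of_bool (surviving (path \<omega>) n) :: real"
  let ?t = "\<lambda>\<omega>. of_bool (surviving (path \<omega>) n \<and> size (path \<omega>) n \<le> v) :: real"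
  let ?b = "\<lambda>\<omega>. of_bool (\<not> big_block (path \<omega>) n) :: real"
  let ?g = "\<lambda>\<omega>. ?s \<omega> * (of_bool (v < size (path \<omega>) n) + \<eta> * ctr * size (path \<omega>) n powr \<gamma>)"
  let ?x = "\<lambda>\<omega>. rlevel (path \<omega>) n powr \<gamma>" and ?y = "\<lambda>\<omega>. rarea (path \<omega>) n powr \<gamma>"
  have s: "integrable M ?s" and t: "integrable M ?t" and b: "integrable M ?b"
    by (intro integrable_of_bool; measurable)+
  have "ctr \<ge> 0" by (simp add: ctr_def)
  have g: "integrable M ?g"
  proof (rule Bochner_Integration.integrable_bound)
    show "integrable M (\<lambda>\<omega>. 1 + \<eta> * ctr * size (path \<omega>) n powr \<gamma>)"
      by (intro Bochner_Integration.integrable_add integrable_mult_right size_moment) simp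
  qed (use \<eta> \<open>ctr \<ge> 0\<close> in auto)
  note tb = past_block_product[of "\<lambda>x. of_bool (surviving x n \<and> size x n \<le> v)" n
      "\<lambda>x. of_bool (\<not> big_block x n)", OF past_functions(2) block_functions(3) _ _ t b]
  have tb: "integrable M (\<lambda>\<omega>. ?t \<omega> * ?b \<omega>)" "expectation (\<lambda>\<omega>. ?t \<omega> * ?b \<omega>) = expectation ?t * expectation ?b"
    by (rule tb; simp add: past_functions block_restrict big_block_def)+
  note sx = past_block_product[of "\<lambda>x. of_bool (surviving x n)" n "\<lambda>x. rlevel x n powr \<gamma>",
      OF past_functions(1) block_functions(1) _ _ s rlevel_moment(1)]
  have sx: "integrable M (\<lambda>\<omega>. ?s \<omega> * ?x \<omega>)" "expectation (\<lambda>\<omega>. ?s \<omega> * ?x \<omega>) = expectation ?s * expectation ?x"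
    by (rule sx; simp add: past_functions block_restrict rlevel_def)+
  note sy = past_block_product[of "\<lambda>x. of_bool (surviving x n)" n "\<lambda>x. rarea x n powr \<gamma>",
      OF past_functions(1) block_functions(2) _ _ s rarea_moment(1)]
  have sy: "integrable M (\<lambda>\<omega>. ?s \<omega> * ?y \<omega>)" "expectation (\<lambda>\<omega>. ?s \<omega> * ?y \<omega>) = expectation ?s * expectation ?y"
    by (rule sy; simp add: past_functions block_restrict rarea_def)+
  have b_le: "expectation ?b \<le> 1 - p"
  proof -
    have "expectation ?b = expectation (\<lambda>\<omega>. 1 - of_bool (big_block (path \<omega>) n))"
      by (simp add: of_bool_not_iff)
    also have "\<dots> = 1 - expectation (\<lambda>\<omega>. of_bool (big_block (path \<omega>) n))"
      by (subst Bochner_Integration.integral_diff) (auto simp: prob_space)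
    finally show ?thesis using big_block_prob[of n] by simp
  qed
  have "expectation (\<lambda>\<omega>. lyap (path \<omega>) (Suc n)) \<le>
      expectation (\<lambda>\<omega>. ?t \<omega> * ?b \<omega> + ?g \<omega> + \<eta> * (?s \<omega> * ?x \<omega> + ?s \<omega> * ?y \<omega>))"
    by (intro integral_mono integrable_lyap Bochner_Integration.integrable_add integrable_mult_right
        tb(1) g sx(1) sy(1) lyap_Suc_le)
  also have "\<dots> = expectation ?t * expectation ?b + expectation ?g
      + \<eta> * (expectation ?s * expectation ?x + expectation ?s * expectation ?y)"
    using tb sx sy g by (simp only: Bochner_Integration.integral_add Bochner_Integration.integrable_add
        integrable_mult_right integral_mult_right_zero)
  also have "\<dots> \<le> expectation ?t * (1 - p) + expectation ?g + \<eta> * (expectation ?s * C + expectation ?s * C)"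
    using b_le rlevel_moment(2) rarea_moment(2) \<eta>
    by (intro add_mono mult_left_mono) (auto intro!: integral_nonneg_AE)
  also have "\<dots> = expectation (\<lambda>\<omega>. ?t \<omega> * (1 - p) + ?g \<omega> + ?s \<omega> * (\<eta> * (2 * C)))"
    using t g s by simp
  also have "\<dots> \<le> expectation (\<lambda>\<omega>. (1 - p / 2) * lyap (path \<omega>) n)"
  proof (intro integral_mono)
    fix \<omega>
    show "?t \<omega> * (1 - p) + ?g \<omega> + ?s \<omega> * (\<eta> * (2 * C)) \<le> (1 - p / 2) * lyap (path \<omega>) n"
      using drift[of "size (path \<omega>) n"] by (simp add: lyap_def)
  qed (use t g s integrable_lyap in auto)
  finally show ?thesis by simp
qed

lemma surviving_prob: "measure M {\<omega> \<in> space M. surviving (path \<omega>) n} \<le> (1 - p / 2) ^ n * 2"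
proof -
  have "expectation (\<lambda>\<omega>. lyap (path \<omega>) n) \<le> (1 - p / 2) ^ n * 2"
  proof (induction n)
    case 0
    have "expectation (\<lambda>\<omega>. lyap (path \<omega>) 0) \<le> expectation (\<lambda>\<omega>. 1 + \<eta> * size (path \<omega>) 0 powr \<gamma>)"
      using \<eta> by (intro integral_mono integrable_lyap Bochner_Integration.integrable_add
        integrable_mult_right size_0_moment) (auto simp: lyap_def)
    also have "\<dots> = 1 + \<eta> * expectation (\<lambda>\<omega>. size (path \<omega>) 0 powr \<gamma>)"
      using size_0_moment(1) by (simp add: prob_space)
    also have "\<dots> \<le> 1 + \<eta> * (2 * C)"
      using size_0_moment(2) \<eta> by simp
    also have "\<dots> \<le> 2" using \<eta>_C p by linarith
    finally show ?case by simp
  next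
    case (Suc n)
    have "(1 - p / 2) * expectation (\<lambda>\<omega>. lyap (path \<omega>) n) \<le> (1 - p / 2) * ((1 - p / 2) ^ n * 2)"
      using Suc p by (intro mult_left_mono) auto
    then show ?case using expectation_lyap_Suc[of n] by simp
  qed
  moreover have "measure M {\<omega> \<in> space M. surviving (path \<omega>) n} = expectation (\<lambda>\<omega>. of_bool (surviving (path \<omega>) n))"
    by (rule prob_eq_expectation_of_bool) measurable
  moreover have "\<dots> \<le> expectation (\<lambda>\<omega>. lyap (path \<omega>) n)"
    using \<eta> by (intro integral_mono integrable_lyap integrable_of_bool) (auto simp: lyap_def)
  ultimately show ?thesis by linarith
qed

end

lemma uniform_survival:
  assumes "0 < \<rho>" "\<rho> < 1" "0 < a"
  obtains q :: real and R :: nat where "0 < q" "q < 1" "2 \<le> R"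
    and "\<And>Q \<alpha> b (M :: 'a measure) \<xi> m n. stable_walk Q \<alpha> b M \<xi> m \<Longrightarrow> a \<le> \<alpha> \<Longrightarrow> measure Q {0<..} = \<rho> \<Longrightarrow>
      measure M {\<omega> \<in> space M. \<forall>j\<le>n. walk_area m (\<lambda>i. \<xi> i \<omega>) 0 (m * R ^ j) < 1} \<le> q ^ n * 2"
proof -
  obtain \<gamma> C \<delta> where \<gamma>: "0 < \<gamma>" "\<gamma> \<le> 1" and C: "0 < C" and \<delta>: "0 < \<delta>"
    and bounds: "\<And>Q \<alpha> b. strictly_stable_law Q \<alpha> b \<Longrightarrow> a \<le> \<alpha> \<Longrightarrow> measure Q {0<..} = \<rho> \<Longrightarrow>
      integrable Q (\<lambda>z. \<bar>z\<bar> powr \<gamma>) \<and> (LINT z|Q. \<bar>z\<bar> powr \<gamma>) \<le> C \<and> \<rho> / 2 \<le> measure Q {\<delta>..}"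
    using strictly_stable_uniform_bounds[OF assms] by metis
  define p where "p = \<rho> / 2"
  define d where "d = \<delta> * (1/2) powr (1 + 1 / a)"
  define \<eta> where "\<eta> = p / (16 * C)"
  define v where "v = (3 * p / \<eta>) powr (1 / \<gamma>)"
  have p: "0 < p" "p \<le> 1" and d: "0 < d" and \<eta>: "0 < \<eta>"
    using assms C \<delta> by (simp_all add: p_def d_def \<eta>_def)
  then have v: "0 < v" by (simp add: v_def)
  obtain r :: nat where r: "max 1 (max (8 powr (1 / \<gamma>)) ((2 * v + 1) / d)) \<le> real r"
    using real_arch_simple by blast
  define R where "R = r\<^sup>2 + 1"
  have r1: "1 \<le> r" using r by auto
  have R: "2 \<le> R" using r1 by (simp add: R_def)
  have "8 powr (1 / \<gamma>) \<le> real r" using r by simp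
  then have "(8 powr (1 / \<gamma>)) powr \<gamma> \<le> real r powr \<gamma>" using \<gamma> by (intro powr_mono2) auto
  then have r8: "8 \<le> real r powr \<gamma>" using \<gamma> by (simp add: powr_powr)
  have contraction: "2 * (1 / real R) powr (\<gamma> / \<alpha>) \<le> 1/4" if "0 < \<alpha>" "\<alpha> \<le> 2" for \<alpha>
  proof -
    have "(1 / real R) powr (\<gamma> / \<alpha>) \<le> (1 / real R) powr (\<gamma> / 2)"
      using that R \<gamma> by (intro powr_mono' divide_left_mono) auto
    also have "\<dots> \<le> (1 / real r powr 2) powr (\<gamma> / 2)"
      using \<gamma> r1 by (intro powr_mono2 divide_left_mono mult_pos_pos) (auto simp: R_def add_pos_nonneg)
    also have "\<dots> = 1 / real r powr \<gamma>" by (simp only: powr_divide powr_powr) simp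
    also have "\<dots> \<le> 1 / 8" using r8 r1 by (intro divide_left_mono) auto
    finally show ?thesis by simp
  qed
  have jump_large: "real R * v + 1 \<le> d * (real R - 1) powr (1 + 1 / \<alpha>)" if "0 < \<alpha>" "\<alpha> \<le> 2" for \<alpha>
  proof -
    have "1 \<le> (real r)\<^sup>2" using r1 by simp
    then have "(real r)\<^sup>2 * v + v + 1 \<le> (real r)\<^sup>2 * v + (real r)\<^sup>2 * v + (real r)\<^sup>2"
      using v by (intro add_mono) auto
    then have "real R * v + 1 \<le> (real r)\<^sup>2 * (2 * v + 1)"
      by (simp add: R_def algebra_simps)
    also have "\<dots> \<le> (real r)\<^sup>2 * (d * real r)"
      using r d by (intro mult_left_mono) (auto simp: field_simps)
    also have "\<dots> = d * (real r powr 2) powr (3/2)"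
    proof -
      have "(real r powr 2) powr (3/2) = real r powr 3" by (simp only: powr_powr) simp
      also have "\<dots> = real r ^ 3" using r1 by simp
      finally show ?thesis by (simp add: power2_eq_square power3_eq_cube)
    qed
    also have "\<dots> = d * (real R - 1) powr (3/2)"
      using r1 by (simp add: R_def)
    also have "\<dots> \<le> d * (real R - 1) powr (1 + 1 / \<alpha>)"
    proof -
      have "1 / 2 \<le> 1 / \<alpha>" using that by (intro divide_left_mono) auto
      then show ?thesis using R d by (intro mult_left_mono powr_mono) auto
    qed
    finally show ?thesis .
  qed
  show thesis
  proof (rule that[of "1 - p / 2" R])
    fix Q \<alpha> b and M :: "'a measure" and \<xi> m n
    assume walk: "stable_walk Q \<alpha> b M \<xi> m" and "a \<le> \<alpha>" and \<rho>: "measure Q {0<..} = \<rho>"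
    then interpret stable_walk Q \<alpha> b M \<xi> m by simp
    have law: "strictly_stable_law Q \<alpha> b" by unfold_locales
    note * = bounds[OF law \<open>a \<le> \<alpha>\<close> \<rho>]
    interpret lyapunov Q \<alpha> b M \<xi> m \<gamma> C p d v \<eta> R
    proof
      have "(1/2) powr (1 + 1 / a) \<le> (1/2) powr (1 + 1 / \<alpha>)"
        using \<open>a \<le> \<alpha>\<close> \<open>0 < a\<close> by (intro powr_mono' add_left_mono divide_left_mono) auto
      then have "d / (1/2) powr (1 + 1 / \<alpha>) \<le> \<delta>"
        using \<delta> by (simp add: d_def field_simps)
      then have "measure Q {\<delta>..} \<le> measure Q {d / (1/2) powr (1 + 1 / \<alpha>)..}"
        by (intro law.finite_measure_mono) auto
      then show "p \<le> measure Q {d / (1/2) powr (1 + 1 / \<alpha>)..}"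
        using * by (simp add: p_def)
      show "\<eta> * (2 * C) \<le> p / 8" using C by (simp add: \<eta>_def)
      show "3 * p \<le> \<eta> * v powr \<gamma>"
        using \<gamma> p \<eta> by (simp add: v_def powr_powr)
    qed (use \<gamma> C p d v \<eta> * R contraction jump_large law.index in auto)
    show "measure M {\<omega> \<in> space M. \<forall>j\<le>n. walk_area m (\<lambda>i. \<xi> i \<omega>) 0 (m * R ^ j) < 1} \<le> (1 - p / 2) ^ n * 2"
      using surviving_prob[of n] by (simp add: surviving_def area_def steps_def)
  qed (use p R in auto)
qed

section \<open>Riemann sums of cadlag paths\<close>

lemma cadlag_bounded:
  assumes "cadlag f"
  obtains B where "\<And>x. x \<in> {0..T} \<Longrightarrow> \<bar>f x\<bar> \<le> B"
proof -
  have local: "\<exists>e>0. \<exists>B. \<forall>x\<in>ball t e. 0 \<le> x \<longrightarrow> \<bar>f x\<bar> \<le> B" if "0 \<le> t" for t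
  proof -
    have "(f \<longlongrightarrow> f t) (at_right t)" using assms that by (simp add: cadlag_def)
    then have "\<forall>\<^sub>F x in at_right t. dist (f x) (f t) < 1" by (rule tendstoD) simp
    then obtain c where c: "t < c" "\<And>x. t < x \<Longrightarrow> x < c \<Longrightarrow> dist (f x) (f t) < 1"
      by (auto simp: eventually_at_right_field)
    have "\<exists>c' l. c' < t \<and> (\<forall>x. c' < x \<longrightarrow> x < t \<longrightarrow> 0 \<le> x \<longrightarrow> dist (f x) l < 1)"
    proof (cases "t = 0")
      case True
      then show ?thesis by (intro exI[of _ "-1"]) auto
    next
      case False
      with that have "0 < t" by simp
      then obtain l where "(f \<longlongrightarrow> l) (at_left t)" using assms by (auto simp: cadlag_def)
      then have "\<forall>\<^sub>F x in at_left t. dist (f x) l < 1" by (rule tendstoD) simp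
      then show ?thesis by (auto simp: eventually_at_left_field)
    qed
    then obtain c' l where c': "c' < t" "\<And>x. c' < x \<Longrightarrow> x < t \<Longrightarrow> 0 \<le> x \<Longrightarrow> dist (f x) l < 1"
      by blast
    show ?thesis
    proof (rule exI[of _ "min (c - t) (t - c')"], intro conjI exI[of _ "\<bar>f t\<bar> + \<bar>l\<bar> + 1"] ballI impI)
      show "0 < min (c - t) (t - c')" using c c' by simp
      fix x assume x: "x \<in> ball t (min (c - t) (t - c'))" "0 \<le> x"
      then have "c' < x" "x < c" by (auto simp: dist_real_def abs_less_iff)
      then consider "x = t" | "t < x" "dist (f x) (f t) < 1" | "x < t" "dist (f x) l < 1"
        using c(2)[of x] c'(2)[of x] x(2) by (cases x t rule: linorder_cases) auto
      then show "\<bar>f x\<bar> \<le> \<bar>f t\<bar> + \<bar>l\<bar> + 1"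
        by cases (auto simp: dist_real_def)
    qed
  qed
  then obtain e B where e: "\<And>t. 0 \<le> t \<Longrightarrow> 0 < e t"
    and B: "\<And>t x. 0 \<le> t \<Longrightarrow> x \<in> ball t (e t) \<Longrightarrow> 0 \<le> x \<Longrightarrow> \<bar>f x\<bar> \<le> B t"
    by metis
  have "{0..T} \<subseteq> (\<Union>t\<in>{0..T}. ball t (e t))"
    using e by (auto intro!: bexI)
  then obtain C where C: "C \<subseteq> {0..T}" "finite C" "{0..T} \<subseteq> (\<Union>t\<in>C. ball t (e t))"
    using compactE_image[OF compact_Icc, of "{0..T}" "\<lambda>t. ball t (e t)" 0 T] by blast
  show thesis
  proof (rule that)
    fix x assume x: "x \<in> {0..T}"
    then obtain t where t: "t \<in> C" "x \<in> ball t (e t)" using C(3) by blast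
    have "0 \<le> t" using t(1) C(1) by auto
    then have "\<bar>f x\<bar> \<le> B t" using t(2) x by (intro B) simp_all
    also have "\<dots> \<le> \<bar>B t\<bar>" by simp
    also have "\<dots> \<le> (\<Sum>t\<in>C. \<bar>B t\<bar>)" using t C by (intro member_le_sum) auto
    finally show "\<bar>f x\<bar> \<le> (\<Sum>t\<in>C. \<bar>B t\<bar>)" .
  qed
qed

definition step_function :: "(real \<Rightarrow> real) \<Rightarrow> nat \<Rightarrow> nat \<Rightarrow> real \<Rightarrow> real" where
  "step_function f T m s = (\<Sum>i\<in>{1..m * T}. f (real i / real m) * indicator {(real i - 1) / real m<..real i / real m} s)"

lemma step_function_eq:
  assumes "0 < m"
  shows "step_function f T m s = (if s \<in> {0<..real T} then f (real (nat \<lceil>s * real m\<rceil>) / real m) else 0)"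
proof -
  have ind: "s \<in> {(real i - 1) / real m<..real i / real m} \<longleftrightarrow> 0 < s \<and> i = nat \<lceil>s * real m\<rceil>" if "1 \<le> i" for i :: nat
  proof -
    have "s \<in> {(real i - 1) / real m<..real i / real m} \<longleftrightarrow> real i - 1 < s * real m \<and> s * real m \<le> real i"
      using assms by (simp add: field_simps)
    also have "\<dots> \<longleftrightarrow> \<lceil>s * real m\<rceil> = int i"
      by (simp add: ceiling_eq_iff)
    also have "\<dots> \<longleftrightarrow> 0 < s \<and> i = nat \<lceil>s * real m\<rceil>"
    proof
      assume *: "\<lceil>s * real m\<rceil> = int i"
      then have "0 < \<lceil>s * real m\<rceil>" using that by simp
      then have "0 < s * real m" by simp
      with * show "0 < s \<and> i = nat \<lceil>s * real m\<rceil>" using assms by (simp add: zero_less_mult_iff)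
    next
      assume *: "0 < s \<and> i = nat \<lceil>s * real m\<rceil>"
      then have "0 < \<lceil>s * real m\<rceil>" using assms by simp
      with * show "\<lceil>s * real m\<rceil> = int i" by simp
    qed
    finally show ?thesis .
  qed
  have "step_function f T m s = (\<Sum>i\<in>{1..m * T}. if i = nat \<lceil>s * real m\<rceil> then (if 0 < s then f (real i / real m) else 0) else 0)"
    unfolding step_function_def
  proof (intro sum.cong refl)
    fix i assume "i \<in> {1..m * T}"
    then show "f (real i / real m) * indicator {(real i - 1) / real m<..real i / real m} s =
        (if i = nat \<lceil>s * real m\<rceil> then (if 0 < s then f (real i / real m) else 0) else 0)"
      using ind[of i] by (auto simp del: greaterThanAtMost_iff simp: indicator_def)
  qed
  also have "\<dots> = (if nat \<lceil>s * real m\<rceil> \<in> {1..m * T} then (if 0 < s then f (real (nat \<lceil>s * real m\<rceil>) / real m) else 0) else 0)"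
    by (simp add: sum.delta)
  also have "\<dots> = (if s \<in> {0<..real T} then f (real (nat \<lceil>s * real m\<rceil>) / real m) else 0)"
  proof (cases "0 < s")
    case True
    then have c: "0 < \<lceil>s * real m\<rceil>" using assms by simp
    have "nat \<lceil>s * real m\<rceil> \<le> m * T \<longleftrightarrow> \<lceil>s * real m\<rceil> \<le> int (m * T)"
      using c by linarith
    also have "\<dots> \<longleftrightarrow> s * real m \<le> real m * real T"
      by (simp add: ceiling_le_iff)
    also have "\<dots> \<longleftrightarrow> s \<le> real T" using assms by (simp add: mult.commute)
    finally show ?thesis using c True by (auto simp: Suc_le_eq)
  qed auto
  finally show ?thesis .
qed

lemma cadlag_step_function:
  assumes f: "cadlag f" and T: "0 < T"
  defines "g \<equiv> \<lambda>s. indicator {0<..real T} s * f s"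
  shows "integrable lborel g"
    and "(\<lambda>m. \<Sum>i\<in>{1..m * T}. f (real i / real m) / real m) \<longlonglongrightarrow> (LINT s|lborel. g s)"
proof -
  obtain B where B: "\<And>x. x \<in> {0..real T} \<Longrightarrow> \<bar>f x\<bar> \<le> B" using cadlag_bounded[OF f] by blast
  have meas: "step_function f T m \<in> borel_measurable borel" for m
    unfolding step_function_def[abs_def] by measurable
  have lim: "(\<lambda>m. step_function f T m s) \<longlonglongrightarrow> g s" for s
  proof (cases "s \<in> {0<..real T}")
    case True
    let ?x = "\<lambda>m. real (nat \<lceil>s * real m\<rceil>) / real m"
    have x: "s \<le> ?x m \<and> ?x m \<le> s + 1 / real m" if "0 < m" for m
    proof -
      have "0 < s * real m" using True that by simp
      then have "real (nat \<lceil>s * real m\<rceil>) = real_of_int \<lceil>s * real m\<rceil>" by simp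
      then have "s * real m \<le> real (nat \<lceil>s * real m\<rceil>)" "real (nat \<lceil>s * real m\<rceil>) \<le> s * real m + 1"
        using ceiling_correct[of "s * real m"] by simp_all
      then show ?thesis using that by (simp add: field_simps)
    qed
    have lim: "?x \<longlonglongrightarrow> s"
    proof (rule tendsto_sandwich[OF _ _ tendsto_const])
      show "(\<lambda>m. s + 1 / real m) \<longlonglongrightarrow> s"
        using tendsto_add[OF tendsto_const lim_1_over_n, of s] by simp
      show "\<forall>\<^sub>F m in sequentially. s \<le> ?x m" "\<forall>\<^sub>F m in sequentially. ?x m \<le> s + 1 / real m"
        by (rule eventually_mono[OF eventually_gt_at_top[of 0]], use x in simp)+
    qed
    have cont: "continuous (at s within {s..}) f"
    proof -
      have "(f \<longlongrightarrow> f s) (at s within {s<..})" using f True by (simp add: cadlag_def)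
      then have "(f \<longlongrightarrow> f s) (at s within insert s {s<..})"
        by (simp add: at_within_def insert_Diff_if)
      moreover have "insert s {s<..} = {s..}" by auto
      ultimately show ?thesis by (simp add: continuous_within)
    qed
    have ev: "\<forall>\<^sub>F m in sequentially. ?x m \<in> {s..}"
      using eventually_gt_at_top[of 0] by (rule eventually_mono) (use x in simp)
    have "(\<lambda>m. f (?x m)) \<longlonglongrightarrow> f s"
      by (rule continuous_within_tendsto_compose[OF cont ev lim])
    moreover have "\<forall>\<^sub>F m in sequentially. f (?x m) = step_function f T m s"
      using True by (intro eventually_sequentiallyI[of 1]) (simp add: step_function_eq)
    ultimately show ?thesis using True by (simp add: g_def Lim_transform_eventually)
  next
    case False
    have "\<forall>\<^sub>F m in sequentially. step_function f T m s = 0"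
      using False by (intro eventually_sequentiallyI[of 1]) (auto simp: step_function_eq)
    then show ?thesis using False by (simp add: g_def tendsto_eventually)
  qed
  have gm: "g \<in> borel_measurable borel"
    by (rule borel_measurable_LIMSEQ_real[OF lim meas])
  have bound: "AE s in lborel. norm (step_function f T m s) \<le> B * indicator {0<..real T} s" for m
  proof (intro AE_I2)
    fix s
    show "norm (step_function f T m s) \<le> B * indicator {0<..real T} s"
    proof (cases "m = 0")
      case True
      have "0 \<le> B" using B[of 0] by force
      then show ?thesis using True by (simp add: step_function_def)
    next
      case False
      have "real (nat \<lceil>s * real m\<rceil>) / real m \<in> {0..real T}" if "s \<in> {0<..real T}"
      proof -
        have "s * real m \<le> real (T * m)" using that by (simp add: mult_right_mono)
        then have "\<lceil>s * real m\<rceil> \<le> int (T * m)" by (simp add: ceiling_le_iff)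
        then have "nat \<lceil>s * real m\<rceil> \<le> T * m" by linarith
        then have "real (nat \<lceil>s * real m\<rceil>) \<le> real T * real m" by (metis of_nat_le_iff of_nat_mult)
        then show ?thesis using False by (simp add: field_simps)
      qed
      then show ?thesis using False B by (auto simp: step_function_eq)
    qed
  qed
  have int: "integrable lborel (\<lambda>s. B * indicator {0<..real T} s)"
    by (intro integrable_mult_right integrable_real_indicator) auto
  show "integrable lborel g"
    by (rule integrable_dominated_convergence[where s = "step_function f T", OF _ _ int _ bound])
      (use gm meas lim in auto)
  have "(\<lambda>m. LINT s|lborel. step_function f T m s) \<longlonglongrightarrow> (LINT s|lborel. g s)"
    by (rule integral_dominated_convergence[where s = "step_function f T", OF _ _ int _ bound])
      (use gm meas lim in auto)
  moreover have "(LINT s|lborel. step_function f T m s) = (\<Sum>i\<in>{1..m * T}. f (real i / real m) / real m)" for m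
    unfolding step_function_def
    by (subst Bochner_Integration.integral_sum)
      (auto intro!: integrable_mult_right integrable_real_indicator sum.cong simp: divide_right_mono diff_divide_distrib)
  ultimately show "(\<lambda>m. \<Sum>i\<in>{1..m * T}. f (real i / real m) / real m) \<longlonglongrightarrow> (LINT s|lborel. g s)"
    by simp
qed

lemma cadlag_set_integral:
  assumes "cadlag f" "0 < T"
  shows "set_integrable lborel {0..real T} f"
    and "(\<lambda>m. \<Sum>i\<in>{1..m * T}. f (real i / real m) / real m) \<longlonglongrightarrow> (LINT s:{0..real T}|lborel. f s)"
proof -
  note g = cadlag_step_function[OF assms]
  have eq: "indicator {0..real T} s * f s = indicator {0<..real T} s * f s + f 0 * indicator {0} s" for s
    by (auto simp: indicator_def)
  have i: "integrable lborel (\<lambda>s. f 0 * indicator {0::real} s)"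
    by (intro integrable_mult_right integrable_real_indicator) auto
  show "set_integrable lborel {0..real T} f"
    using g(1) i by (simp add: set_integrable_def eq)
  have "(LINT s:{0..real T}|lborel. f s) = (LINT s|lborel. indicator {0<..real T} s * f s)"
    using g(1) i by (simp add: set_lebesgue_integral_def eq)
  with g(2) show "(\<lambda>m. \<Sum>i\<in>{1..m * T}. f (real i / real m) / real m) \<longlonglongrightarrow> (LINT s:{0..real T}|lborel. f s)"
    by simp
qed

lemma cadlag_integral_reaches_one:
  assumes "cadlag f" "0 < T" "1 \<le> (LINT s:{0..real T}|lborel. f s)"
  obtains s where "0 < s" "s \<le> real T" "(LINT u:{0..s}|lborel. f u) = 1"
proof -
  have int: "set_integrable lborel {0..s} f" if "s \<le> real T" for s
    by (rule set_integrable_subset[OF cadlag_set_integral(1)[OF assms(1,2)]]) (use that in auto)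
  have eq: "(LINT u:{0..s}|lborel. f u) = integral {0..s} f" if "s \<le> real T" for s
    by (rule set_borel_integral_eq_integral(2)[OF int[OF that]])
  have "continuous_on {0..real T} (\<lambda>s. integral {0..s} f)"
    by (rule indefinite_integral_continuous_1, rule set_borel_integral_eq_integral(1)[OF int]) simp
  then obtain s where s: "0 \<le> s" "s \<le> real T" "integral {0..s} f = 1"
    using IVT'[of "\<lambda>s. integral {0..s} f" 0 1 "real T"] assms(3) eq[of "real T"] by auto
  then have "s \<noteq> 0" by auto
  with s eq[of s] show thesis by (intro that[of s]) auto
qed

lemma not_reached_lt_one:
  assumes "cadlag (\<lambda>t. Z t \<omega>)" "0 < T" "real T \<le> t" "hitting_time_one (integrated Z) \<omega> > ereal t"
  shows "integrated Z (real T) \<omega> < 1"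
proof (rule ccontr)
  assume "\<not> ?thesis"
  then obtain s where s: "0 < s" "s \<le> real T" "integrated Z s \<omega> = 1"
    using cadlag_integral_reaches_one[OF assms(1,2)] unfolding integrated_def by (metis not_less)
  then have "hitting_time_one (integrated Z) \<omega> \<le> ereal s"
    unfolding hitting_time_one_def by (intro Inf_lower) auto
  also have "\<dots> \<le> ereal t" using s assms(3) by simp
  finally show False using assms(4) by simp
qed

lemma walk_area_eq_riemann_sum:
  "walk_area m (\<lambda>i. f (real (Suc i) / real m) - f (real i / real m)) 0 k =
    (\<Sum>i\<in>{1..k}. (f (real i / real m) - f 0) / real m)"
proof (induction k)
  case (Suc k)
  define x where "x = (\<lambda>i. f (real (Suc i) / real m) - f (real i / real m))"
  have w: "walk x 0 k = f (real k / real m) - f 0" for k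
    by (induction k) (simp_all add: walk_def x_def)
  have "walk_area m x 0 (Suc k) = walk_area m x 0 k + 1 / real m * walk x 0 k + x k / real m"
    using walk_area_add[of m x k 1] by (simp add: walk_area_def)
  also have "walk_area m x 0 k = (\<Sum>i\<in>{1..k}. (f (real i / real m) - f 0) / real m)"
    unfolding x_def by (rule Suc)
  finally show ?case
    unfolding w unfolding x_def by (simp add: diff_divide_distrib)
qed (simp add: walk_area_def)

section \<open>Stable processes\<close>

lemma abs_mult_tan_le_1:
  assumes "0 < \<alpha>" "\<alpha> \<le> 2"
  shows "\<bar>\<alpha> - 1\<bar> * \<bar>tan (pi * \<alpha> / 2)\<bar> \<le> 1"
proof -
  have pos: "x * cos x \<le> sin x" if "0 \<le> x" "x \<le> pi" for x :: real
  proof -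
    have "sin 0 - 0 * cos 0 \<le> sin x - x * cos x"
    proof (rule DERIV_nonneg_imp_nondecreasing[OF that(1)])
      fix y assume "0 \<le> y" "y \<le> x"
      then show "\<exists>D. ((\<lambda>y. sin y - y * cos y) has_real_derivative D) (at y) \<and> 0 \<le> D"
        using that by (intro exI[of _ "y * sin y"]) (auto intro!: derivative_eq_intros mult_nonneg_nonneg sin_ge_zero)
    qed
    then show ?thesis by simp
  qed
  define x where "x = pi * \<bar>\<alpha> - 1\<bar> / 2"
  have x: "0 \<le> x" "x \<le> pi / 2" using assms by (auto simp: x_def abs_le_iff)
  have tan: "\<bar>tan (pi * \<alpha> / 2)\<bar> = \<bar>cos x\<bar> / \<bar>sin x\<bar>"
  proof -
    have *: "pi * \<alpha> / 2 = pi / 2 + pi * (\<alpha> - 1) / 2" by (simp add: field_simps)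
    have "\<bar>tan (pi * \<alpha> / 2)\<bar> = \<bar>cos (pi * (\<alpha> - 1) / 2)\<bar> / \<bar>sin (pi * (\<alpha> - 1) / 2)\<bar>"
      unfolding * tan_def sin_add cos_add by (simp add: abs_divide)
    moreover have "pi * (\<alpha> - 1) / 2 = x \<or> pi * (\<alpha> - 1) / 2 = - x"
      by (auto simp: x_def abs_if algebra_simps)
    ultimately show ?thesis by auto
  qed
  have "\<bar>\<alpha> - 1\<bar> * 1 \<le> \<bar>\<alpha> - 1\<bar> * (pi / 2)"
    using pi_ge_two by (intro mult_left_mono) auto
  then have "\<bar>\<alpha> - 1\<bar> \<le> x" by (simp add: x_def mult.commute)
  moreover have c: "0 \<le> cos x" using x by (intro cos_ge_zero) auto
  ultimately have "\<bar>\<alpha> - 1\<bar> * cos x \<le> x * cos x" by (intro mult_right_mono)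
  also have "\<dots> \<le> sin x" using x pi_ge_two by (intro pos) auto
  finally have le: "\<bar>\<alpha> - 1\<bar> * cos x \<le> sin x" .
  moreover have "0 \<le> \<bar>\<alpha> - 1\<bar> * cos x" using c by simp
  ultimately have "0 \<le> sin x" by linarith
  show ?thesis
    using le c \<open>0 \<le> sin x\<close> unfolding tan by (cases "sin x = 0") (auto simp: divide_le_eq)
qed

lemma unit_scale_law:
  assumes "stable_process M \<alpha> Z" "unit_scale M \<alpha> Z"
  obtains b where "strictly_stable_law (distr M borel (Z 1)) \<alpha> b"
proof -
  interpret levy_process M Z using assms by (simp add: stable_process_def)
  have \<alpha>: "0 < \<alpha>" "\<alpha> \<le> 2" using assms by (auto simp: stable_process_def)
  interpret law: real_distribution "distr M borel (Z 1)"
    by (rule real_distribution_distr) (simp add: measurable_Z)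
  show thesis
  proof (cases "\<alpha> = 1")
    case True
    then obtain d where d: "\<And>\<theta>. char (distr M borel (Z 1)) \<theta> = exp (- stable_exponent_one d \<theta>)"
      using assms(2) by (auto simp: unit_scale_def)
    have "stable_exponent_one d \<theta> = strict_exponent 1 d \<theta>" for \<theta>
      by (simp add: stable_exponent_one_def complex_eq_iff sgn_if)
    then show thesis using True \<alpha> d by (intro that[of d]) (unfold_locales, simp_all)
  next
    case False
    then obtain \<beta> where \<beta>: "\<beta> \<in> {-1..1}"
      "\<And>\<theta>. char (distr M borel (Z 1)) \<theta> = exp (- stable_exponent \<alpha> \<beta> \<theta>)"
      using assms(2) by (auto simp: unit_scale_def)
    define b where "b = \<beta> * tan (pi * \<alpha> / 2)"
    have "stable_exponent \<alpha> \<beta> \<theta> = strict_exponent \<alpha> b \<theta>" for \<theta>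
      by (simp add: stable_exponent_def strict_exponent_def b_def mult.commute mult.left_commute)
    moreover have "\<bar>\<alpha> - 1\<bar> * \<bar>b\<bar> \<le> 1"
    proof -
      have "\<bar>\<alpha> - 1\<bar> * \<bar>b\<bar> = \<bar>\<beta>\<bar> * (\<bar>\<alpha> - 1\<bar> * \<bar>tan (pi * \<alpha> / 2)\<bar>)"
        by (simp add: b_def abs_mult)
      also have "\<dots> \<le> 1 * 1"
        using \<beta> abs_mult_tan_le_1[OF \<alpha>] by (intro mult_mono) auto
      finally show ?thesis by simp
    qed
    ultimately show thesis using \<alpha> \<beta> by (intro that[of b]) (unfold_locales, simp_all)
  qed
qed

lemma (in levy_process) distr_from_start:
  assumes "0 \<le> t"
  shows "distr M borel (\<lambda>\<omega>. Z t \<omega> - Z 0 \<omega>) = distr M borel (Z t)"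
proof (rule distr_cong_AE)
  show "AE \<omega> in M. Z t \<omega> - Z 0 \<omega> = Z t \<omega>"
    using start_zero by eventually_elim simp
qed (use assms in \<open>auto intro!: borel_measurable_diff measurable_Z\<close>)

lemma distr_self_similar:
  assumes "stable_process M \<alpha> Z" "0 < k"
  shows "distr M borel (Z k) = distr M borel (\<lambda>\<omega>. k powr (1 / \<alpha>) * Z 1 \<omega>)"
proof -
  interpret levy_process M Z using assms by (simp add: stable_process_def)
  let ?P = "Pi\<^sub>M {0::real..} (\<lambda>_. borel :: real measure)"
  have e: "(\<lambda>f. f 1) \<in> borel_measurable ?P" by (rule measurable_component_singleton) simp
  have m: "(\<lambda>\<omega>. \<lambda>x\<in>{0..}. Z (k * x) \<omega>) \<in> measurable M ?P"
    "(\<lambda>\<omega>. \<lambda>x\<in>{0..}. k powr (1 / \<alpha>) * Z x \<omega>) \<in> measurable M ?P"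
    by (intro measurable_restrict borel_measurable_times borel_measurable_const measurable_Z;
        use assms(2) in simp)+
  have "distr M ?P (\<lambda>\<omega>. \<lambda>x\<in>{0..}. Z (k * x) \<omega>) = distr M ?P (\<lambda>\<omega>. \<lambda>x\<in>{0..}. k powr (1 / \<alpha>) * Z x \<omega>)"
    using assms by (simp add: stable_process_def self_similar_def)
  then have "distr (distr M ?P (\<lambda>\<omega>. \<lambda>x\<in>{0..}. Z (k * x) \<omega>)) borel (\<lambda>f. f 1) =
      distr (distr M ?P (\<lambda>\<omega>. \<lambda>x\<in>{0..}. k powr (1 / \<alpha>) * Z x \<omega>)) borel (\<lambda>f. f 1)"
    by simp
  then show ?thesis
    using distr_distr[OF e m(1)] distr_distr[OF e m(2)] by (simp add: comp_def)
qed

lemma stable_walk_of_process: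
  assumes "stable_process M \<alpha> Z" "strictly_stable_law (distr M borel (Z 1)) \<alpha> b" "0 < m"
  shows "stable_walk (distr M borel (Z 1)) \<alpha> b M
    (\<lambda>i \<omega>. Z (real (Suc i) / real m) \<omega> - Z (real i / real m) \<omega>) m"
proof -
  interpret levy_process M Z using assms by (simp add: stable_process_def)
  interpret law: strictly_stable_law "distr M borel (Z 1)" \<alpha> b by fact
  let ?\<xi> = "\<lambda>i \<omega>. Z (real (Suc i) / real m) \<omega> - Z (real i / real m) \<omega>"
  show ?thesis
  proof
    show "0 < m" by fact
    show "indep_vars (\<lambda>_. borel) ?\<xi> {..<n}" for n
      by (rule independent_increments[of "\<lambda>i. real i / real m"]) (auto simp: divide_right_mono)
    fix i \<theta>
    define c where "c = (1 / real m) powr (1 / \<alpha>)"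
    have "distr M borel (?\<xi> i) = distr M borel (\<lambda>\<omega>. Z (1 / real m) \<omega> - Z 0 \<omega>)"
      using stationary_increments[of "real i / real m" "1 / real m"]
      by (simp add: add_divide_distrib add.commute)
    also have "\<dots> = distr M borel (Z (1 / real m))"
      by (rule distr_from_start) simp
    also have "\<dots> = distr M borel (\<lambda>\<omega>. c * Z 1 \<omega>)"
      unfolding c_def using assms by (intro distr_self_similar) auto
    also have "\<dots> = distr (distr M borel (Z 1)) borel (\<lambda>z. c * z)"
      by (subst distr_distr) (auto simp: comp_def measurable_Z)
    finally have "char (distr M borel (?\<xi> i)) \<theta> = exp (- (of_real (c powr \<alpha>) * strict_exponent \<alpha> b \<theta>))"
      by (simp add: law.char_distr_scale c_def)
    also have "c powr \<alpha> = 1 / real m"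
      using law.index by (simp add: c_def powr_powr)
    finally show "char (distr M borel (?\<xi> i)) \<theta> = exp (- (strict_exponent \<alpha> b \<theta> / of_nat m))"
      by simp
  qed
qed

lemma hitting_time_tail:
  assumes "0 < \<rho>" "\<rho> < 1" "0 < a"
  obtains q :: real and R :: nat where "0 < q" "q < 1" "2 \<le> R"
    and "\<And>\<alpha> (M :: 'a measure) Z n. a \<le> \<alpha> \<Longrightarrow> stable_process M \<alpha> Z \<Longrightarrow> unit_scale M \<alpha> Z \<Longrightarrow>
      positivity_parameter M Z = \<rho> \<Longrightarrow>
      measure M {\<omega> \<in> space M. hitting_time_one (integrated Z) \<omega> > ereal (real R ^ n)} \<le> q ^ n * 2"
proof -
  obtain q :: real and R :: nat where q: "0 < q" "q < 1" and R: "2 \<le> R"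
    and survival: "\<And>Q \<alpha> b (M :: 'a measure) \<xi> m n. stable_walk Q \<alpha> b M \<xi> m \<Longrightarrow> a \<le> \<alpha> \<Longrightarrow> measure Q {0<..} = \<rho> \<Longrightarrow>
      measure M {\<omega> \<in> space M. \<forall>j\<le>n. walk_area m (\<lambda>i. \<xi> i \<omega>) 0 (m * R ^ j) < 1} \<le> q ^ n * 2"
    by (rule uniform_survival[OF assms, where 'a = 'a]) (rule that)
  show thesis
  proof (rule that[OF q R])
    fix \<alpha> and M :: "'a measure" and Z n
    assume "a \<le> \<alpha>" and stable: "stable_process M \<alpha> Z" and unit: "unit_scale M \<alpha> Z"
      and \<rho>: "positivity_parameter M Z = \<rho>"
    interpret levy_process M Z using stable by (simp add: stable_process_def)
    obtain b where law: "strictly_stable_law (distr M borel (Z 1)) \<alpha> b"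
      using unit_scale_law[OF stable unit] .
    have pos: "measure (distr M borel (Z 1)) {0<..} = \<rho>"
      using \<rho> measurable_Z[of 1]
      by (simp add: measure_distr positivity_parameter_def vimage_def Int_def conj_commute)
    let ?\<xi> = "\<lambda>m i \<omega>. Z (real (Suc i) / real m) \<omega> - Z (real i / real m) \<omega>"
    define E where "E m = {\<omega> \<in> space M. \<forall>j\<le>n. walk_area m (\<lambda>i. ?\<xi> m i \<omega>) 0 (m * R ^ j) < 1}" for m
    have walk: "stable_walk (distr M borel (Z 1)) \<alpha> b M (?\<xi> m) m" if "0 < m" for m
      by (rule stable_walk_of_process[OF stable law that])
    have E_le: "measure M (E m) \<le> q ^ n * 2" if "0 < m" for m
      unfolding E_def by (rule survival[OF walk[OF that] \<open>a \<le> \<alpha>\<close> pos])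
    have E_sets [measurable]: "E m \<in> sets M" for m
    proof -
      have [measurable]: "?\<xi> m i \<in> borel_measurable M" for i
        by (intro borel_measurable_diff measurable_Z) auto
      show ?thesis unfolding E_def walk_area_def by measurable
    qed
    define G where "G k = (\<Inter>m\<in>{Suc k..}. E m)" for k
    have G_sets: "G k \<in> sets M" for k unfolding G_def by measurable
    have "incseq G" by (force simp: incseq_def G_def)
    have "measure M (G k) \<le> q ^ n * 2" for k
    proof -
      have "measure M (G k) \<le> measure M (E (Suc k))"
        by (intro finite_measure_mono) (auto simp: G_def)
      then show ?thesis using E_le[of "Suc k"] by simp
    qed
    moreover have "(\<lambda>k. measure M (G k)) \<longlonglongrightarrow> measure M (\<Union>k. G k)"
      using G_sets \<open>incseq G\<close> by (intro finite_Lim_measure_incseq) auto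
    ultimately have le: "measure M (\<Union>k. G k) \<le> q ^ n * 2"
      by (intro LIMSEQ_le_const2) auto
    have "AE \<omega> in M. \<omega> \<in> {\<omega> \<in> space M. hitting_time_one (integrated Z) \<omega> > ereal (real R ^ n)} \<longrightarrow> \<omega> \<in> (\<Union>k. G k)"
      using start_zero AE_space
    proof eventually_elim
      case (elim \<omega>)
      show ?case
      proof
        assume "\<omega> \<in> {\<omega> \<in> space M. hitting_time_one (integrated Z) \<omega> > ereal (real R ^ n)}"
        then have hit: "hitting_time_one (integrated Z) \<omega> > ereal (real R ^ n)" by simp
        have cad: "cadlag (\<lambda>t. Z t \<omega>)" using elim by (intro cadlag_paths)
        have "\<forall>\<^sub>F m in sequentially. walk_area m (\<lambda>i. ?\<xi> m i \<omega>) 0 (m * R ^ j) < 1" if "j \<le> n" for j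
        proof -
          have T: "0 < R ^ j" using R by simp
          have "R ^ j \<le> R ^ n" using that R by (intro power_increasing) auto
          then have "real (R ^ j) \<le> real R ^ n" by (metis of_nat_le_iff of_nat_power)
          then have "integrated Z (real (R ^ j)) \<omega> < 1"
            by (rule not_reached_lt_one[where Z = Z, OF cad T _ hit])
          moreover have "(\<lambda>m. walk_area m (\<lambda>i. ?\<xi> m i \<omega>) 0 (m * R ^ j)) \<longlonglongrightarrow> integrated Z (real (R ^ j)) \<omega>"
            using cadlag_set_integral(2)[OF cad T] elim
            unfolding walk_area_eq_riemann_sum[where f = "\<lambda>t. Z t \<omega>"] integrated_def by simp
          ultimately show ?thesis by (simp add: order_tendstoD(2))
        qed
        then have "\<forall>\<^sub>F m in sequentially. \<forall>j\<in>{..n}. walk_area m (\<lambda>i. ?\<xi> m i \<omega>) 0 (m * R ^ j) < 1"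
          by (intro eventually_ball_finite) auto
        then obtain k where "\<And>m j. k \<le> m \<Longrightarrow> j \<le> n \<Longrightarrow> walk_area m (\<lambda>i. ?\<xi> m i \<omega>) 0 (m * R ^ j) < 1"
          unfolding eventually_sequentially by auto
        then have "\<omega> \<in> G k" using elim by (auto simp: G_def E_def)
        then show "\<omega> \<in> (\<Union>k. G k)" by blast
      qed
    qed
    then have "measure M {\<omega> \<in> space M. hitting_time_one (integrated Z) \<omega> > ereal (real R ^ n)} \<le> measure M (\<Union>k. G k)"
      using G_sets by (intro finite_measure_mono_AE) auto
    with le show "measure M {\<omega> \<in> space M. hitting_time_one (integrated Z) \<omega> > ereal (real R ^ n)} \<le> q ^ n * 2"
      by linarith
  qed
qed

lemma Liminf_eq_0_along_sequence:
  fixes g :: "real \<Rightarrow> real"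
  assumes "\<And>t. 0 \<le> g t" "filterlim s at_top sequentially" "(\<lambda>n. g (s n)) \<longlonglongrightarrow> 0"
  shows "Liminf at_top (\<lambda>t. ereal (g t)) = 0"
proof (rule antisym)
  show "0 \<le> Liminf at_top (\<lambda>t. ereal (g t))"
    by (rule Liminf_bounded) (use assms(1) in simp)
  show "Liminf at_top (\<lambda>t. ereal (g t)) \<le> 0"
  proof (rule ccontr)
    assume "\<not> ?thesis"
    then have "0 < Liminf at_top (\<lambda>t. ereal (g t))" by (simp add: not_le)
    then obtain y where y: "0 < y" "y < Liminf at_top (\<lambda>t. ereal (g t))"
      using dense by blast
    have "\<forall>\<^sub>F n in sequentially. y < ereal (g (s n))"
      using less_LiminfD[OF y(2)] assms(2) by (rule eventually_compose_filterlim)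
    moreover have "(\<lambda>n. ereal (g (s n))) \<longlonglongrightarrow> 0"
      using assms(3) by (simp add: zero_ereal_def)
    then have "\<forall>\<^sub>F n in sequentially. ereal (g (s n)) < y"
      using y(1) by (rule order_tendstoD)
    ultimately have "\<forall>\<^sub>F n in sequentially. False"
      by eventually_elim auto
    then show False by simp
  qed
qed

lemma decay_exponent_exists:
  assumes "0 < \<rho>" "\<rho> < 1" "0 < \<alpha>\<^sub>0"
  shows "\<exists>\<kappa>>0. decay_exponent TYPE('a) \<rho> \<alpha>\<^sub>0 \<kappa>"
proof -
  obtain q :: real and R :: nat where q: "0 < q" "q < 1" and R: "2 \<le> R"
    and tail: "\<And>\<alpha> (M :: 'a measure) Z n. \<alpha>\<^sub>0 \<le> \<alpha> \<Longrightarrow> stable_process M \<alpha> Z \<Longrightarrow> unit_scale M \<alpha> Z \<Longrightarrow>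
      positivity_parameter M Z = \<rho> \<Longrightarrow>
      measure M {\<omega> \<in> space M. hitting_time_one (integrated Z) \<omega> > ereal (real R ^ n)} \<le> q ^ n * 2"
    by (rule hitting_time_tail[OF assms, where 'a = 'a]) (rule that)
  define \<kappa> where "\<kappa> = ln (1 / sqrt q) / ln (real R)"
  have "sqrt q < 1" using q by simp
  then have \<kappa>: "0 < \<kappa>" unfolding \<kappa>_def using q R by (intro divide_pos_pos ln_gt_zero) auto
  have R_\<kappa>: "real R powr \<kappa> = 1 / sqrt q"
    using q R by (simp add: \<kappa>_def powr_def)
  have "decay_exponent TYPE('a) \<rho> \<alpha>\<^sub>0 \<kappa>"
    unfolding decay_exponent_def
  proof (intro ballI impI allI, elim conjE)
    fix \<alpha> and M :: "'a measure" and Z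
    assume \<alpha>: "\<alpha> \<in> {\<alpha>\<^sub>0..2}" and stable: "stable_process M \<alpha> Z" and unit: "unit_scale M \<alpha> Z"
      and \<rho>: "positivity_parameter M Z = \<rho>"
    let ?P = "\<lambda>t. measure M {\<omega> \<in> space M. hitting_time_one (integrated Z) \<omega> > ereal t}"
    show "Liminf at_top (\<lambda>t. ereal (t powr \<kappa> * ?P t)) = 0"
    proof (rule Liminf_eq_0_along_sequence)
      show "filterlim (\<lambda>n. real R ^ n) at_top sequentially"
      proof (rule filterlim_at_top_mono[OF filterlim_real_sequentially])
        have "real n \<le> real (R ^ n)" for n
          using power_gt_expt[of R n] R by (intro of_nat_mono) simp
        then show "\<forall>\<^sub>F n in sequentially. real n \<le> real R ^ n" by simp
      qed
      show "(\<lambda>n. (real R ^ n) powr \<kappa> * ?P (real R ^ n)) \<longlonglongrightarrow> 0"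
      proof (rule tendsto_sandwich[OF _ _ tendsto_const])
        have "(real R ^ n) powr \<kappa> * ?P (real R ^ n) \<le> sqrt q ^ n * 2" for n
        proof -
          have pw: "(real R ^ n) powr \<kappa> = (1 / sqrt q) ^ n"
            using R by (simp add: R_\<kappa>[symmetric] powr_realpow[symmetric] powr_powr mult.commute)
          have "(real R ^ n) powr \<kappa> * ?P (real R ^ n) \<le> (1 / sqrt q) ^ n * (q ^ n * 2)"
            unfolding pw using q \<alpha> by (intro mult_left_mono tail[OF _ stable unit \<rho>]) auto
          also have "\<dots> = (1 / sqrt q * q) ^ n * 2" by (simp only: power_mult_distrib mult.assoc)
          also have "1 / sqrt q * q = sqrt q" using q by (simp add: real_div_sqrt)
          finally show ?thesis .
        qed
        then show "\<forall>\<^sub>F n in sequentially. (real R ^ n) powr \<kappa> * ?P (real R ^ n) \<le> sqrt q ^ n * 2"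
          by simp
        show "(\<lambda>n. sqrt q ^ n * 2) \<longlonglongrightarrow> 0"
          using q by (intro tendsto_mult_left_zero LIMSEQ_realpow_zero) auto
      qed simp
    qed simp
  qed
  with \<kappa> show ?thesis by blast
qed

section \<open>Transfer to path space\<close>

definition path_of :: "(real \<Rightarrow> 'a \<Rightarrow> real) \<Rightarrow> 'a \<Rightarrow> real \<Rightarrow> real" where
  "path_of Z \<omega> = (\<lambda>t. Z t \<omega>)"

text \<open>The \<open>\<sigma>\<close>-algebra is the final one, not the one generated by the coordinates.\<close>

definition path_space :: "'a measure \<Rightarrow> (real \<Rightarrow> 'a \<Rightarrow> real) \<Rightarrow> (real \<Rightarrow> real) measure" where
  "path_space M Z = sigma {f. cadlag f} {B. B \<subseteq> {f. cadlag f} \<and> path_of Z -` B \<inter> space M \<in> sets M}"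

definition path_law :: "'a measure \<Rightarrow> (real \<Rightarrow> 'a \<Rightarrow> real) \<Rightarrow> (real \<Rightarrow> real) measure" where
  "path_law M Z = distr M (path_space M Z) (path_of Z)"

definition coordinate :: "real \<Rightarrow> (real \<Rightarrow> real) \<Rightarrow> real" where
  "coordinate t f = f t"

lemma coordinate_path_of [simp]: "coordinate t (path_of Z \<omega>) = Z t \<omega>"
  by (simp add: coordinate_def path_of_def)

lemma space_path_space [simp]: "space (path_space M Z) = {f. cadlag f}"
  unfolding path_space_def by (rule space_measure_of) auto

context levy_process
begin

lemma path_of_cadlag: "\<omega> \<in> space M \<Longrightarrow> cadlag (path_of Z \<omega>)"
  unfolding path_of_def by (rule cadlag_paths)

lemma sets_path_space:
  "sets (path_space M Z) = {B. B \<subseteq> {f. cadlag f} \<and> path_of Z -` B \<inter> space M \<in> sets M}"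
proof -
  let ?S = "{f. cadlag f}"
  let ?A = "{B. B \<subseteq> ?S \<and> path_of Z -` B \<inter> space M \<in> sets M}"
  have "sigma_algebra ?S ?A"
  proof (unfold sigma_algebra_iff2, intro conjI ballI allI impI)
    show "?A \<subseteq> Pow ?S" "{} \<in> ?A" by auto
    show "?S - B \<in> ?A" if "B \<in> ?A" for B
    proof -
      have "path_of Z -` (?S - B) \<inter> space M = space M - (path_of Z -` B \<inter> space M)"
        using path_of_cadlag by auto
      then show ?thesis using that by auto
    qed
    show "(\<Union>i. B i) \<in> ?A" if "range B \<subseteq> ?A" for B :: "nat \<Rightarrow> _"
    proof -
      have "path_of Z -` (\<Union>i. B i) \<inter> space M = (\<Union>i. path_of Z -` B i \<inter> space M)"
        by auto
      also have "\<dots> \<in> sets M" using that by (intro sets.countable_UN) auto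
      finally show ?thesis using that by blast
    qed
  qed
  then have "sigma_sets ?S ?A = ?A" by (rule sigma_algebra.sigma_sets_eq)
  then show ?thesis unfolding path_space_def by (subst sets_measure_of) auto
qed

lemma measurable_path_of [measurable]: "path_of Z \<in> measurable M (path_space M Z)"
  by (rule measurableI) (auto simp: path_of_cadlag sets_path_space)

lemma measurable_coordinate:
  assumes "0 \<le> t"
  shows "coordinate t \<in> borel_measurable (path_space M Z)"
proof (rule measurableI)
  fix B :: "real set" assume "B \<in> sets borel"
  have "path_of Z -` (coordinate t -` B \<inter> space (path_space M Z)) \<inter> space M = Z t -` B \<inter> space M"
    using path_of_cadlag by (auto simp: path_of_def coordinate_def)
  then show "coordinate t -` B \<inter> space (path_space M Z) \<in> sets (path_space M Z)"
    using measurable_sets[OF measurable_Z[OF assms] \<open>B \<in> sets borel\<close>] by (auto simp: sets_path_space)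
qed simp

text \<open>No measurability is needed: a set of paths is an event of the path law exactly when its
  preimage is an event, and the measure of a non-event is \<open>0\<close>.\<close>

lemma measure_path_law:
  "measure (path_law M Z) {f \<in> space (path_law M Z). P f} = measure M {\<omega> \<in> space M. P (path_of Z \<omega>)}"
proof -
  let ?B = "{f \<in> space (path_law M Z). P f}"
  have pre: "path_of Z -` ?B \<inter> space M = {\<omega> \<in> space M. P (path_of Z \<omega>)}"
    using path_of_cadlag by (auto simp: path_law_def)
  show ?thesis
  proof (cases "?B \<in> sets (path_space M Z)")
    case True
    then show ?thesis
      unfolding path_law_def by (subst measure_distr) (use pre in \<open>auto simp: path_law_def\<close>)
  next
    case False
    moreover have "{\<omega> \<in> space M. P (path_of Z \<omega>)} \<notin> sets M"
    proof
      assume "{\<omega> \<in> space M. P (path_of Z \<omega>)} \<in> sets M"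
      with pre have "?B \<in> sets (path_space M Z)"
        by (auto simp: sets_path_space path_law_def)
      with False show False by simp
    qed
    ultimately show ?thesis
      by (simp add: measure_notin_sets path_law_def)
  qed
qed

lemma AE_path_lawD: "(AE f in path_law M Z. P f) \<Longrightarrow> AE \<omega> in M. P (path_of Z \<omega>)"
  unfolding path_law_def by (rule AE_distrD[OF measurable_path_of])

lemma distr_path_law:
  "h \<in> measurable (path_space M Z) L \<Longrightarrow> distr (path_law M Z) L h = distr M L (\<lambda>\<omega>. h (path_of Z \<omega>))"
  unfolding path_law_def by (subst distr_distr) (auto simp: comp_def)

lemma measurable_path_law [simp]: "measurable (path_law M Z) L = measurable (path_space M Z) L"
  by (simp add: path_law_def)

lemma measurable_increment:
  "0 \<le> s \<Longrightarrow> 0 \<le> t \<Longrightarrow> (\<lambda>f. coordinate t f - coordinate s f) \<in> borel_measurable (path_space M Z)"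
  by (intro borel_measurable_diff measurable_coordinate)

lemma levy_process_path_law: "levy_process (path_law M Z) coordinate"
proof -
  interpret L: prob_space "path_law M Z"
    unfolding path_law_def by (rule prob_space_distr) measurable
  show ?thesis
  proof
    show "coordinate t \<in> borel_measurable (path_law M Z)" if "0 \<le> t" for t
      using measurable_coordinate[OF that] by simp
    have "{f \<in> space (path_space M Z). coordinate 0 f = 0} \<in> sets (path_space M Z)"
      using measurable_coordinate[of 0] by (intro borel_measurable_eq) auto
    then show "AE f in path_law M Z. coordinate 0 f = 0"
      unfolding path_law_def using start_zero by (subst AE_distr_iff) auto
    show "cadlag (\<lambda>t. coordinate t f)" if "f \<in> space (path_law M Z)" for f
      using that by (simp add: path_law_def coordinate_def)
    show "distr (path_law M Z) borel (\<lambda>f. coordinate (s + h) f - coordinate s f) =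
        distr (path_law M Z) borel (\<lambda>f. coordinate h f - coordinate 0 f)" if "0 \<le> s" "0 \<le> h" for s h
      using that stationary_increments[OF that] by (simp add: distr_path_law measurable_increment)
    fix n :: nat and t :: "nat \<Rightarrow> real"
    assume t0: "0 \<le> t 0" and t: "\<And>i. i < n \<Longrightarrow> t i \<le> t (Suc i)"
    have nonneg: "0 \<le> t i" if "i \<le> n" for i
      using that by (induction i) (use t0 t order_trans in \<open>auto simp: Suc_le_eq\<close>)
    let ?d = "\<lambda>i f. coordinate (t (Suc i)) f - coordinate (t i) f"
    show "L.indep_vars (\<lambda>_. borel) ?d {..<n}"
    proof (cases "n = 0")
      case True
      then show ?thesis by (simp add: L.indep_vars_def L.indep_sets_def)
    next
      case False
      have d: "?d i \<in> borel_measurable (path_space M Z)" if "i < n" for i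
        using that nonneg by (intro measurable_increment) auto
      have r: "(\<lambda>f. \<lambda>i\<in>{..<n}. ?d i f) \<in> measurable (path_space M Z) (Pi\<^sub>M {..<n} (\<lambda>_. borel))"
        using d by (intro measurable_restrict) auto
      have dM: "(\<lambda>\<omega>. Z (t (Suc i)) \<omega> - Z (t i) \<omega>) \<in> borel_measurable M" if "i < n" for i
        using that nonneg by (intro borel_measurable_diff measurable_Z) auto
      have *: "distr M (Pi\<^sub>M {..<n} (\<lambda>_. borel)) (\<lambda>\<omega>. \<lambda>i\<in>{..<n}. Z (t (Suc i)) \<omega> - Z (t i) \<omega>) =
          Pi\<^sub>M {..<n} (\<lambda>i. distr M borel (\<lambda>\<omega>. Z (t (Suc i)) \<omega> - Z (t i) \<omega>))"
        using False dM independent_increments[of t n, OF t0 t]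
        by (subst indep_vars_iff_distr_eq_PiM'[symmetric]) auto
      then have "distr (path_law M Z) (Pi\<^sub>M {..<n} (\<lambda>_. borel)) (\<lambda>f. \<lambda>i\<in>{..<n}. ?d i f) =
          Pi\<^sub>M {..<n} (\<lambda>i. distr (path_law M Z) borel (?d i))"
      proof -
        have "Pi\<^sub>M {..<n} (\<lambda>i. distr (path_law M Z) borel (?d i)) =
            Pi\<^sub>M {..<n} (\<lambda>i. distr M borel (\<lambda>\<omega>. Z (t (Suc i)) \<omega> - Z (t i) \<omega>))"
          by (intro PiM_cong refl) (simp add: distr_path_law d)
        with * show ?thesis by (simp add: distr_path_law[OF r])
      qed
      then show ?thesis
        using False d by (subst L.indep_vars_iff_distr_eq_PiM') auto
    qed
  qed
qed

lemma levy_process_uminus: "levy_process M (\<lambda>t \<omega>. - Z t \<omega>)"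
proof
  show "(\<lambda>\<omega>. - Z t \<omega>) \<in> borel_measurable M" if "0 \<le> t" for t
    using measurable_Z[OF that] by simp
  show "AE \<omega> in M. - Z 0 \<omega> = 0" using start_zero by simp
  show "cadlag (\<lambda>t. - Z t \<omega>)" if "\<omega> \<in> space M" for \<omega>
    using cadlag_paths[OF that] unfolding cadlag_def by (metis tendsto_minus)
  have neg: "distr M borel (\<lambda>\<omega>. - Z t \<omega> - - Z s \<omega>) = distr (distr M borel (\<lambda>\<omega>. Z t \<omega> - Z s \<omega>)) borel uminus"
    if "0 \<le> s" "0 \<le> t" for s t
  proof -
    have "(\<lambda>\<omega>. Z t \<omega> - Z s \<omega>) \<in> borel_measurable M"
      using that by (intro borel_measurable_diff measurable_Z)
    then show ?thesis by (subst distr_distr) (auto simp: comp_def)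
  qed
  show "distr M borel (\<lambda>\<omega>. - Z (s + h) \<omega> - - Z s \<omega>) = distr M borel (\<lambda>\<omega>. - Z h \<omega> - - Z 0 \<omega>)"
    if "0 \<le> s" "0 \<le> h" for s h
    using that stationary_increments[OF that] by (simp only: neg add_nonneg_nonneg order_refl)
  show "indep_vars (\<lambda>_. borel) (\<lambda>i \<omega>. - Z (t (Suc i)) \<omega> - - Z (t i) \<omega>) {..<n}"
    if "0 \<le> t 0" "\<And>i. i < n \<Longrightarrow> t i \<le> t (Suc i)" for n :: nat and t
    using indep_vars_compose2[OF independent_increments[of t n, OF that], of "\<lambda>_. uminus" "\<lambda>_. borel"]
    by simp
qed

end

lemma decay_exponent_transfer:
  assumes "decay_exponent TYPE(real \<Rightarrow> real) \<rho> \<alpha>\<^sub>0 \<kappa>"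
  shows "decay_exponent TYPE('a) \<rho> \<alpha>\<^sub>0 \<kappa>"
  unfolding decay_exponent_def
proof (intro ballI impI allI, elim conjE)
  fix \<alpha> and M :: "'a measure" and Z
  assume \<alpha>: "\<alpha> \<in> {\<alpha>\<^sub>0..2}" "\<rho> \<in> admissible_positivity \<alpha>" and stable: "stable_process M \<alpha> Z"
    and unit: "unit_scale M \<alpha> Z" and \<rho>: "positivity_parameter M Z = \<rho>"
    and jumps: "has_negative_jumps M Z" and subord: "\<not> subordinator M (\<lambda>t \<omega>. - Z t \<omega>)"
  interpret levy_process M Z using stable by (simp add: stable_process_def)
  let ?L = "path_law M Z"
  have "stable_process ?L \<alpha> coordinate"
  proof -
    have "self_similar ?L (1 / \<alpha>) coordinate"
      unfolding self_similar_def
    proof (intro allI impI)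
      fix k :: real assume "0 < k"
      let ?P = "Pi\<^sub>M {0::real..} (\<lambda>_. borel :: real measure)"
      have m: "(\<lambda>f. \<lambda>x\<in>{0..}. coordinate (k * x) f) \<in> measurable (path_space M Z) ?P"
        "(\<lambda>f. \<lambda>x\<in>{0..}. k powr (1 / \<alpha>) * coordinate x f) \<in> measurable (path_space M Z) ?P"
        by (intro measurable_restrict borel_measurable_times borel_measurable_const measurable_coordinate;
            use \<open>0 < k\<close> in simp)+
      have "distr M ?P (\<lambda>\<omega>. \<lambda>x\<in>{0..}. Z (k * x) \<omega>) = distr M ?P (\<lambda>\<omega>. \<lambda>x\<in>{0..}. k powr (1 / \<alpha>) * Z x \<omega>)"
        using stable \<open>0 < k\<close> by (simp add: stable_process_def self_similar_def)
      then show "distr ?L ?P (\<lambda>f. \<lambda>x\<in>{0..}. coordinate (k * x) f) =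
          distr ?L ?P (\<lambda>f. \<lambda>x\<in>{0..}. k powr (1 / \<alpha>) * coordinate x f)"
        by (simp add: distr_path_law[OF m(1)] distr_path_law[OF m(2)])
    qed
    then show ?thesis
      using stable levy_process_path_law by (simp add: stable_process_def)
  qed
  moreover have "unit_scale ?L \<alpha> coordinate"
    using unit distr_path_law[OF measurable_coordinate[of 1]] by (simp add: unit_scale_def)
  moreover have "positivity_parameter ?L coordinate = \<rho>"
    using \<rho> measure_path_law[of "\<lambda>f. coordinate 1 f > 0"] by (simp add: positivity_parameter_def)
  moreover have "has_negative_jumps ?L coordinate"
    using jumps AE_path_lawD[of "\<lambda>f. \<forall>t>0. \<not> jump (\<lambda>s. coordinate s f) t < 0"]
    by (auto simp: has_negative_jumps_def)
  moreover have "\<not> subordinator ?L (\<lambda>t f. - coordinate t f)"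
    using subord levy_process_uminus AE_path_lawD[of "\<lambda>f. mono_on {0..} (\<lambda>t. - coordinate t f)"]
    by (auto simp: subordinator_def)
  ultimately have "Liminf at_top (\<lambda>t. ereal (t powr \<kappa> *
      measure ?L {f \<in> space ?L. hitting_time_one (integrated coordinate) f > ereal t})) = 0"
    using assms \<alpha> unfolding decay_exponent_def by blast
  moreover have "hitting_time_one (integrated coordinate) (path_of Z \<omega>) = hitting_time_one (integrated Z) \<omega>" for \<omega>
    by (simp add: hitting_time_one_def integrated_def)
  ultimately show "Liminf at_top (\<lambda>t. ereal (t powr \<kappa> *
      measure M {\<omega> \<in> space M. hitting_time_one (integrated Z) \<omega> > ereal t})) = 0"
    by (simp add: measure_path_law)
qed

theorem theoremB:
  fixes \<rho> \<alpha>\<^sub>0 :: real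
  assumes "0 < \<rho>" and "\<rho> < 1" and "0 < \<alpha>\<^sub>0"
  shows "(\<exists>\<kappa>>0. decay_exponent TYPE(real \<Rightarrow> real) \<rho> \<alpha>\<^sub>0 \<kappa>) \<and>
    (\<forall>\<kappa>>0. decay_exponent TYPE(real \<Rightarrow> real) \<rho> \<alpha>\<^sub>0 \<kappa> \<longrightarrow> decay_exponent TYPE('a) \<rho> \<alpha>\<^sub>0 \<kappa>)"
  using decay_exponent_exists[OF assms] decay_exponent_transfer by blast

end
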